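(* For every $\tau\in\mathbb{H}^2$ set $$x=x(\tau)=\frac{\eta^3(\tau)\,\eta^6(3\tau/2)\,\eta^3(6\tau)}{\eta^2(\tau/2)\,\eta(2\tau)\,\eta^9(3\tau)} .$$ Then $$\{x,\tau\}+\frac{2\left(x^2-x+1\right)^4}{x^2(x-1)^2(x+1)^2(x-2)^2(2x-1)^2}\,(x')^2=0 .$$
   Context: $\mathbb{H}^2=\{\tau\in\mathbb{C}\mid \Im\tau>0\}$; $\eta(\tau)=e^{2\pi i\tau/24}\prod_{n\ge1}(1-e^{2\pi i n\tau})$ is the Dedekind eta function and $\eta^k(r\tau)=(\eta(r\tau))^k$. The prime denotes $d/d\tau$, and the Schwarzian derivative of $y=y(s)$ is $\{y,s\}=\frac{y'''}{y'}-\frac32\left(\frac{y''}{y'}\right)^2$, derivatives being taken with respect to $s$. *)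

theory Defs
  imports "HOL-Analysis.Analysis"
begin

definition upper_half_plane :: "complex set" where
  "upper_half_plane = {\<tau>. Im \<tau> > 0}"

text \<open>
  The product \<open>\<Prod>n\<ge>1\<close> is shifted, because \<open>prodinf\<close> starts at index \<open>0\<close>.
  The value is only meaningful on the upper half-plane.
\<close>

definition dedekind_eta :: "complex \<Rightarrow> complex" where
  "dedekind_eta \<tau> =
     exp (2 * pi * \<i> * \<tau> / 24) * (\<Prod>n. 1 - exp (2 * pi * \<i> * of_nat (Suc n) * \<tau>))"

definition schwarzian :: "(complex \<Rightarrow> complex) \<Rightarrow> complex \<Rightarrow> complex" where
  "schwarzian y s =
     (deriv ^^ 3) y s / deriv y s - 3 / 2 * ((deriv ^^ 2) y s / deriv y s)\<^sup>2"

definition x_fun :: "complex \<Rightarrow> complex" where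
  "x_fun \<tau> =
     (dedekind_eta \<tau> ^ 3 * dedekind_eta (3 * \<tau> / 2) ^ 6 * dedekind_eta (6 * \<tau>) ^ 3) /
     (dedekind_eta (\<tau> / 2) ^ 2 * dedekind_eta (2 * \<tau>) * dedekind_eta (3 * \<tau>) ^ 9)"

end

theory Submission
  imports Defs "HOL-Complex_Analysis.Complex_Analysis"
begin

text \<open>
  In terms of the nome \<open>q = exp (\<pi> \<i> \<tau>)\<close> the function \<open>x\<close> is a rational parameter of the modular equation
  of degree 3, and the Schwarzian equation is the pullback of the one for the modular function
  \<open>\<lambda> = \<theta>\<^sub>2\<^sup>4 / \<theta>\<^sub>3\<^sup>4\<close> along the covering \<open>\<lambda> = (x - 1) (x + 1)\<^sup>3 / (2 x - 1)\<^sup>3\<close>, whose ramification lies above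
  \<open>0\<close>, \<open>1\<close> and \<open>\<infinity>\<close> only. All functions are holomorphic in the unit disc of the variable \<open>q\<close>, and Landen's
  transformation \<open>q \<mapsto> q\<^sup>2\<close> does the work of modularity.

  The differential side. Write \<open>\<phi>\<close> and \<open>\<psi>\<close> for the series over \<open>\<int>\<close> with exponents \<open>n\<^sup>2\<close> and \<open>n (n + 1) / 2\<close>.
  Rotating the square lattice by 45 degrees gives Landen's formulas (\<open>phi_mult_phi_neg\<close>, \<open>phi_squares\<close>,
  \<open>psi_square\<close>). Under \<open>q \<mapsto> q\<^sup>2\<close> the defect of Jacobi's formula for the derivative of \<open>\<theta>\<^sub>3 / \<theta>\<^sub>4\<close>, taken as a
  quotient, is invariant, and the defect of the Riccati equation for the logarithmic derivative of \<open>\<theta>\<^sub>3\<^sup>2\<close> is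
  multiplied by \<open>1/4\<close>. As \<open>q ^ (2 ^ n)\<close> tends to \<open>0\<close>, both defects are determined by their behaviour at the
  origin (\<open>logderiv_phi_ratio\<close>, \<open>theta_riccati\<close>). The same iteration shows that \<open>\<phi>\<close> and \<open>\<psi>\<close> have no zeros.

  The algebraic side. The unit group of the Eisenstein integers yields
  \<open>\<phi>(q) \<phi>(q\<^sup>3) - \<phi>(-q) \<phi>(-q\<^sup>3) = q \<psi>(q\<^sup>2) \<psi>(q\<^sup>6)\<close> (\<open>cubic_theta_identity\<close>). Together with
  \<open>\<theta>\<^sub>3\<^sup>4 = \<theta>\<^sub>2\<^sup>4 + \<theta>\<^sub>4\<^sup>4\<close> it determines the sum and the product of \<open>\<lambda>(q)\<close> and \<open>\<lambda>(q\<^sup>3)\<close> in terms of one function,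
  and their difference through a conic, whose rational parametrisation expresses all of them by one
  holomorphic function (\<open>modular_lambda_hauptmodul\<close>). Gauss's product for \<open>\<phi>(-q)\<close> (\<open>gauss_theta_product\<close>), a limit of the
  \<open>q\<close>-binomial theorem, identifies the eighth power of this function with that of the eta quotient, and continuity
  identifies the functions themselves (\<open>eta_quotient_eq_hauptmodul\<close>). The parametrisation also shows that \<open>x\<close>
  avoids the finite singular values.

  Finally \<open>x\<close>, \<open>\<theta>\<^sub>3\<^sup>2\<close> and the logarithmic derivative of \<open>\<theta>\<^sub>3\<^sup>2\<close> form a closed system of first-order equations,
  from which the Schwarzian derivative is computed (\<open>schwarzian_of_theta_system\<close>).
\<close>

section \<open>Theta series\<close>

definition qseries :: "(int \<Rightarrow> nat) \<Rightarrow> complex \<Rightarrow> complex" where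
  "qseries e q = (\<Sum>\<^sub>\<infinity>n. q ^ e n)"

text \<open>
  The growth condition is stated along the two halves \<open>n \<ge> 0\<close> and \<open>n < 0\<close> of \<open>\<int>\<close> separately, which
  lets the geometric series dominate both of them with the same bound.
\<close>

definition admissible :: "(int \<Rightarrow> nat) \<Rightarrow> bool" where
  "admissible e \<longleftrightarrow> (\<forall>n. n \<le> e (int n) \<and> n \<le> e (-1 - int n))"

text \<open>
  Sums over \<open>\<int>\<close> are convenient for changes of variables in lattices, series over \<open>\<nat>\<close> for uniform
  and dominated convergence. The reflection \<open>n \<mapsto> -1 - n\<close> exchanges the two halves of \<open>\<int>\<close>.
\<close>

lemma infsum_int_halves:
  fixes f :: "int \<Rightarrow> 'a::banach"
  assumes "summable (\<lambda>n. norm (f (int n)))" "summable (\<lambda>n. norm (f (-1 - int n)))"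
  shows "(\<lambda>n. norm (f n)) summable_on UNIV"
    and "infsum f UNIV = (\<Sum>n. f (int n) + f (-1 - int n))"
proof -
  have U: "UNIV = range int \<union> range (\<lambda>n. -1 - int n)"
  proof (intro set_eqI iffI UNIV_I)
    fix k :: int
    show "k \<in> range int \<union> range (\<lambda>n. -1 - int n)"
    proof (cases "k \<ge> 0")
      case True
      then have "k = int (nat k)" by simp
      then show ?thesis by blast
    next
      case False
      then have "k = -1 - int (nat (-1 - k))" by simp
      then show ?thesis by blast
    qed
  qed
  have disj: "range int \<inter> range (\<lambda>n. -1 - int n) = {}" by auto
  have inj: "inj int" "inj (\<lambda>n. -1 - int n)" by (auto simp: inj_on_def)
  have n1: "(\<lambda>n. norm (f n)) summable_on range int"
    using summable_nonneg_imp_summable_on[OF assms(1)]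
    by (simp add: summable_on_reindex[OF inj(1)] o_def)
  have n2: "(\<lambda>n. norm (f n)) summable_on range (\<lambda>n. -1 - int n)"
    using summable_nonneg_imp_summable_on[OF assms(2)]
    by (simp add: summable_on_reindex[OF inj(2)] o_def)
  show "(\<lambda>n. norm (f n)) summable_on UNIV"
    by (subst U, rule summable_on_Un_disjoint[OF n1 n2 disj])
  have i1: "infsum f (range int) = (\<Sum>n. f (int n))"
    using norm_summable_imp_has_sum[OF assms(1) summable_sums[OF summable_norm_cancel[OF assms(1)]]]
    by (simp add: infsum_reindex[OF inj(1)] o_def infsumI)
  have i2: "infsum f (range (\<lambda>n. -1 - int n)) = (\<Sum>n. f (-1 - int n))"
    using norm_summable_imp_has_sum[OF assms(2) summable_sums[OF summable_norm_cancel[OF assms(2)]]]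
    by (simp add: infsum_reindex[OF inj(2)] o_def infsumI)
  have "infsum f UNIV = infsum f (range int) + infsum f (range (\<lambda>n. -1 - int n))"
    by (subst U, rule infsum_Un_disjoint[OF abs_summable_summable[OF n1] abs_summable_summable[OF n2] disj])
  then show "infsum f UNIV = (\<Sum>n. f (int n) + f (-1 - int n))"
    by (simp add: i1 i2 suminf_add[OF summable_norm_cancel[OF assms(1)] summable_norm_cancel[OF assms(2)]])
qed

lemma qseries_halves:
  assumes e: "admissible e" and q: "norm q < 1"
  shows "(\<lambda>n. norm (q ^ e n)) summable_on UNIV"
    and "qseries e q = (\<Sum>n. q ^ e (int n) + q ^ e (-1 - int n))"
proof -
  have *: "summable (\<lambda>n. norm (q ^ h n))" if "\<And>n. n \<le> h n" for h :: "nat \<Rightarrow> nat"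
  proof (rule summable_comparison_test)
    show "summable (\<lambda>n. norm q ^ n)" using q by (simp add: summable_geometric)
    show "\<exists>N. \<forall>n\<ge>N. norm (norm (q ^ h n)) \<le> norm q ^ n"
      using that q by (auto simp: norm_power intro!: power_decreasing)
  qed
  have 1: "summable (\<lambda>n. norm (q ^ e (int n)))" "summable (\<lambda>n. norm (q ^ e (-1 - int n)))"
    using e by (auto intro!: * simp: admissible_def)
  show "(\<lambda>n. norm (q ^ e n)) summable_on UNIV"
    by (rule infsum_int_halves(1)[OF 1])
  show "qseries e q = (\<Sum>n. q ^ e (int n) + q ^ e (-1 - int n))"
    unfolding qseries_def by (rule infsum_int_halves(2)[OF 1])
qed

lemma holomorphic_qseries:
  assumes e: "admissible e"
  shows "qseries e holomorphic_on ball 0 1"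
proof (rule holomorphic_uniform_sequence[OF open_ball])
  show "(\<lambda>q. \<Sum>n<N. q ^ e (int n) + q ^ e (-1 - int n)) holomorphic_on ball 0 1" for N
    by (intro holomorphic_intros)
  fix z :: complex assume "z \<in> ball 0 1"
  then obtain d where d: "d > 0" "cball z d \<subseteq> ball 0 1"
    by (meson open_ball open_contains_cball)
  define r where "r = norm z + d"
  have r: "norm x \<le> r" if "x \<in> cball z d" for x
    using that norm_triangle_ineq2[of x z] by (simp add: r_def dist_norm norm_minus_commute)
  have r1: "r < 1" "r \<ge> 0"
  proof -
      \<comment> \<open>The point of the closed disc that is farthest from the origin shows that the radius is below 1.\<close>
  define y where "y = (if z = 0 then of_real d else z + of_real d * sgn z)"
    have ny: "norm y = r"
    proof (cases "z = 0")
      case False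
      then have "y = sgn z * of_real (norm z + d)"
        by (simp add: y_def sgn_eq field_simps)
      then show ?thesis using False d by (simp add: norm_mult norm_sgn r_def del: of_real_add)
    qed (use d in \<open>simp add: y_def r_def\<close>)
    have "y \<in> cball z d" using d by (auto simp: y_def dist_norm norm_mult norm_sgn)
    then have "y \<in> ball 0 1" using d by blast
    with ny show "r < 1" by simp
    show "r \<ge> 0" using d by (simp add: r_def)
  qed
  have "uniform_limit (cball z d) (\<lambda>N q. \<Sum>n<N. q ^ e (int n) + q ^ e (-1 - int n))
          (\<lambda>q. \<Sum>n. q ^ e (int n) + q ^ e (-1 - int n)) sequentially"
  proof (rule Weierstrass_m_test)
    show "summable (\<lambda>n. 2 * r ^ n)" using r1 by (simp add: summable_geometric)
    fix n x assume x: "x \<in> cball z d"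
    have pw: "norm (x ^ k) \<le> r ^ n" if "n \<le> k" for k
    proof -
      have "norm (x ^ k) \<le> r ^ k" using r[OF x] by (simp add: norm_power power_mono)
      also have "\<dots> \<le> r ^ n" using r1 that by (intro power_decreasing) auto
      finally show ?thesis .
    qed
    have "norm (x ^ e (int n) + x ^ e (-1 - int n)) \<le> norm (x ^ e (int n)) + norm (x ^ e (-1 - int n))"
      by (rule norm_triangle_ineq)
    also have "\<dots> \<le> r ^ n + r ^ n"
      using e by (intro add_mono pw) (auto simp: admissible_def)
    finally show "norm (x ^ e (int n) + x ^ e (-1 - int n)) \<le> 2 * r ^ n" by simp
  qed
  also have "?this \<longleftrightarrow> uniform_limit (cball z d) (\<lambda>N q. \<Sum>n<N. q ^ e (int n) + q ^ e (-1 - int n))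
          (qseries e) sequentially"
    using d qseries_halves(2)[OF e] by (intro uniform_limit_cong') (auto simp: subset_eq)
  finally show "\<exists>d>0. cball z d \<subseteq> ball 0 1 \<and>
     uniform_limit (cball z d) (\<lambda>N q. \<Sum>n<N. q ^ e (int n) + q ^ e (-1 - int n)) (qseries e) sequentially"
    using d by blast
qed

definition sqr :: "int \<Rightarrow> nat" where "sqr n = nat (n\<^sup>2)"
definition tri :: "int \<Rightarrow> nat" where "tri n = nat (n * (n + 1) div 2)"

text \<open>
  Jacobi's theta constants in the nome: \<open>phi q\<close> is \<open>\<theta>\<^sub>3\<close>, \<open>phi (- q)\<close> is \<open>\<theta>\<^sub>4\<close>, and
  \<open>q powr (1/4) * psi (q\<^sup>2)\<close> is \<open>\<theta>\<^sub>2\<close>. Summing over all of \<open>\<int>\<close> makes \<open>psi\<close> twice Ramanujan's function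
  of that name; in particular \<open>psi 0 = 2\<close>.
\<close>

definition phi :: "complex \<Rightarrow> complex" where
  "phi = qseries sqr"

definition psi :: "complex \<Rightarrow> complex" where
  "psi = qseries tri"

lemma admissible_phi: "admissible sqr"
proof -
  have A: "k \<le> k\<^sup>2" if "k \<ge> 0" for k :: int
    using that mult_right_mono[of 1 k k] by (cases "k = 0") (auto simp: power2_eq_square)
  have "(-1 - int n)\<^sup>2 = (1 + int n)\<^sup>2" for n by (simp add: power2_eq_square algebra_simps)
  moreover have "int n \<le> (int n)\<^sup>2" "int n \<le> (1 + int n)\<^sup>2" for n
    using A[of "int n"] A[of "1 + int n"] by linarith+
  ultimately show ?thesis by (simp add: admissible_def sqr_def le_nat_iff)
qed

lemma admissible_psi: "admissible tri"
proof -
  have A: "int n \<le> int n * (int n + 1) div 2" for n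
  proof (cases "n = 0")
    case False
    then have "int n * 2 \<le> int n * (int n + 1)" by (intro mult_left_mono) auto
    then show ?thesis by linarith
  qed auto
  have B: "(-1 - int n) * ((-1 - int n) + 1) = int n * (int n + 1)" for n by (simp add: algebra_simps)
  show ?thesis unfolding admissible_def tri_def B using A by (simp add: le_nat_iff)
qed

lemmas holomorphic_phi = holomorphic_qseries[OF admissible_phi, folded phi_def]
lemmas holomorphic_psi = holomorphic_qseries[OF admissible_psi, folded psi_def]

lemma phi_0: "phi 0 = 1"
proof -
  have "infsum (\<lambda>n::int. (0::complex) ^ nat (n\<^sup>2)) UNIV = infsum (\<lambda>n::int. (0::complex) ^ nat (n\<^sup>2)) {0}"
    by (rule infsum_cong_neutral) (auto simp: power_0_left)
  then show ?thesis by (simp add: phi_def qseries_def sqr_def)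
qed

lemma psi_0: "psi 0 = 2"
proof -
  have z: "nat (n * (n + 1) div 2) \<noteq> 0" if "n \<notin> {0, -1}" for n :: int
  proof -
    have "n * (n + 1) \<ge> 2"
    proof (cases "n > 0")
      case True
      then have "1 * 2 \<le> n * (n + 1)" by (intro mult_mono) auto
      then show ?thesis by simp
    next
      case False
      with that have "n \<le> -2" by auto
      then have "2 * 1 \<le> (-n) * (-n - 1)" by (intro mult_mono) auto
      then show ?thesis by (simp add: algebra_simps)
    qed
    then show ?thesis by linarith
  qed
  have "infsum (\<lambda>n::int. (0::complex) ^ nat (n * (n + 1) div 2)) UNIV =
        infsum (\<lambda>n::int. (0::complex) ^ nat (n * (n + 1) div 2)) {0, -1}"
    using z by (intro infsum_cong_neutral) (auto simp: power_0_left)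
  then show ?thesis by (simp add: psi_def qseries_def tri_def)
qed

section \<open>Quadratic identities between theta series\<close>

lemma int_sqr [simp]: "int (sqr n) = n\<^sup>2"
  by (simp add: sqr_def)

lemma int_tri: "2 * int (tri n) = n * (n + 1)"
proof -
  have "n * (n + 1) \<ge> 0"
    by (cases "n \<ge> 0") (auto simp: mult_nonpos_nonpos zero_le_mult_iff)
  then show ?thesis by (simp add: tri_def)
qed

text \<open>
  A product of two theta constants is a sum over \<open>\<int> \<times> \<int>\<close>. Each identity below comes from splitting
  this lattice by the parity of \<open>m + n\<close> and parametrising each half by \<open>\<int> \<times> \<int>\<close> again.
\<close>

definition even_pairs :: "(int \<times> int) set" where "even_pairs = {(m, n). even (m + n)}"
definition odd_pairs :: "(int \<times> int) set" where "odd_pairs = {(m, n). odd (m + n)}"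

lemma pairs_Un: "even_pairs \<union> odd_pairs = UNIV" and pairs_Int: "even_pairs \<inter> odd_pairs = {}"
  by (auto simp: even_pairs_def odd_pairs_def)

lemma bij_even_sum_diff: "bij_betw (\<lambda>(s, t). (s + t, s - t)) UNIV even_pairs"
  by (rule bij_betw_byWitness[where f' = "\<lambda>(m, n). ((m + n) div 2, (m - n) div 2)"])
     ((auto simp: even_pairs_def; presburger)+)

lemma bij_odd_sum_diff: "bij_betw (\<lambda>(s, t). (s + t + 1, s - t)) UNIV odd_pairs"
  by (rule bij_betw_byWitness[where f' = "\<lambda>(m, n). ((m + n) div 2, (m - n) div 2)"])
     ((auto simp: odd_pairs_def; presburger)+)

lemma bij_odd_tri: "bij_betw (\<lambda>(s, t). (s + t, t - s - 1)) UNIV odd_pairs"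
  by (rule bij_betw_byWitness[where f' = "\<lambda>(m, n). ((m - n) div 2, (m + n + 1) div 2)"])
     ((auto simp: odd_pairs_def; presburger)+)

text \<open>
  These four maps encode multiplication by the cube roots of unity in the ring of Eisenstein integers.
  A pair \<open>(s, t)\<close> stands for \<open>((2 s + 1) + (2 t + 1) \<surd>-3) / 2\<close>, and \<open>(m, n)\<close> for \<open>m + n \<surd>-3\<close>.
  If \<open>s + t\<close> is odd, one of the two nontrivial cube roots takes the former into the latter ring; if
  \<open>s + t\<close> is even, the other one does. The parameters \<open>(t, k)\<close> are chosen such that \<open>bij_odd_half\<close>
  and \<open>bij_odd_omega\<close> describe corresponding elements, and so do \<open>bij_even_half\<close> and \<open>bij_odd_omega'\<close>.
\<close>

lemma bij_odd_omega: "bij_betw (\<lambda>(t, k). (2 * t - k + 1, - k)) UNIV odd_pairs"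
  by (rule bij_betw_byWitness[where f' = "\<lambda>(m, n). ((m - n) div 2, - n)"])
     ((auto simp: odd_pairs_def; presburger)+)

lemma bij_odd_half: "bij_betw (\<lambda>(t, k). (2 * k - 1 - t, t)) UNIV odd_pairs"
  by (rule bij_betw_byWitness[where f' = "\<lambda>(s, t). (t, (s + t + 1) div 2)"])
     ((auto simp: odd_pairs_def; presburger)+)

lemma bij_odd_omega': "bij_betw (\<lambda>(t, k). (- k - t - 1, k - t)) UNIV odd_pairs"
  by (rule bij_betw_byWitness[where f' = "\<lambda>(m, n). (- ((m + n + 1) div 2), n - (m + n + 1) div 2)"])
     ((auto simp: odd_pairs_def; presburger)+)

lemma bij_even_half: "bij_betw (\<lambda>(t, k). (2 * k - t, t)) UNIV even_pairs"
  by (rule bij_betw_byWitness[where f' = "\<lambda>(s, t). (t, (s + t) div 2)"])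
     ((auto simp: even_pairs_def; presburger)+)

lemma qseries_mult:
  assumes e: "admissible d" "admissible e" and q: "norm a < 1" "norm b < 1"
  shows "((\<lambda>(m, n). a ^ d m * b ^ e n) has_sum qseries d a * qseries e b) UNIV"
proof -
  have s1: "(\<lambda>n. norm (a ^ d n)) summable_on UNIV" "(\<lambda>n. norm (b ^ e n)) summable_on UNIV"
    using qseries_halves(1) e q by blast+
  have h: "((\<lambda>n. a ^ d n) has_sum qseries d a) UNIV" "((\<lambda>n. b ^ e n) has_sum qseries e b) UNIV"
    using s1[THEN abs_summable_summable] by (simp_all add: qseries_def has_sum_infsum)
  have "(\<lambda>p. norm (case p of (m, n) \<Rightarrow> a ^ d m * b ^ e n)) summable_on (UNIV \<times> UNIV)"
  proof (rule summable_on_SigmaI)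
    show "((\<lambda>y. norm (case (x, y) of (m, n) \<Rightarrow> a ^ d m * b ^ e n)) has_sum
            norm (a ^ d x) * (\<Sum>\<^sub>\<infinity>n. norm (b ^ e n))) UNIV" for x
      using has_sum_cmult_right[OF has_sum_infsum[OF s1(2)]] by (simp add: norm_mult)
    show "(\<lambda>x. norm (a ^ d x) * (\<Sum>\<^sub>\<infinity>n. norm (b ^ e n))) summable_on UNIV"
      by (rule summable_on_cmult_left[OF s1(1)])
  qed auto
  then have "(\<lambda>(m, n). a ^ d m * b ^ e n) summable_on (UNIV \<times> UNIV)"
    by (rule abs_summable_summable)
  then have "((\<lambda>(m, n). a ^ d m * b ^ e n) has_sum qseries d a * qseries e b) (UNIV \<times> UNIV)"
    by (rule has_sum_SigmaI[rotated 2, where g = "\<lambda>m. a ^ d m * qseries e b"])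
       (use has_sum_cmult_right[OF h(2)] has_sum_cmult_left[OF h(1)] in auto)
  then show ?thesis by simp
qed

lemma qseries_mult_split:
  assumes "admissible d" "admissible e" "norm a < 1" "norm b < 1"
  shows "qseries d a * qseries e b =
           (\<Sum>\<^sub>\<infinity>(m,n)\<in>even_pairs. a ^ d m * b ^ e n) + (\<Sum>\<^sub>\<infinity>(m,n)\<in>odd_pairs. a ^ d m * b ^ e n)"
proof -
  note h = qseries_mult[OF assms]
  then have s: "(\<lambda>(m, n). a ^ d m * b ^ e n) summable_on A" for A
    by (blast intro: summable_on_subset_banach has_sum_imp_summable)
  show ?thesis
    using infsum_Un_disjoint[OF s s pairs_Int] infsumI[OF h] by (simp add: pairs_Un)
qed

lemma neg_power_sqr: "(- q :: complex) ^ sqr n = (if even n then q ^ sqr n else - (q ^ sqr n))"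
proof -
  have "even (sqr n) \<longleftrightarrow> even n" by (simp add: sqr_def even_nat_iff)
  then show ?thesis by simp
qed

lemma power_mult_same: "(q::complex) ^ j * q ^ k = q ^ l" if "int j + int k = int l"
  using that by (metis of_nat_add of_nat_eq_iff power_add)

lemma norm_power_lt_1: "norm (q ^ k) < 1" if "norm (q :: complex) < 1" "k > 0"
  using that by (simp add: norm_power power_less_one_iff)

text \<open>
  Pairs of different parity cancel under \<open>(m, n) \<mapsto> (n, m)\<close>; on the others, rotation by 45 degrees
  doubles the quadratic form.
\<close>

lemma phi_mult_phi_neg:
  assumes q: "norm q < 1"
  shows "phi q * phi (- q) = (phi (- (q\<^sup>2)))\<^sup>2"
proof -
  have q2: "norm (- (q\<^sup>2)) < 1" using norm_power_lt_1[OF q, of 2] by simp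
  let ?f = "\<lambda>(m, n). q ^ sqr m * (- q) ^ sqr n"
  have "infsum ?f odd_pairs = infsum (\<lambda>x. ?f (prod.swap x)) odd_pairs"
    by (rule infsum_reindex_bij_betw[symmetric])
       (auto intro!: bij_betw_byWitness[where f' = prod.swap] simp: odd_pairs_def)
  also have "\<dots> = infsum (\<lambda>x. - ?f x) odd_pairs"
    by (rule infsum_cong) (auto simp: odd_pairs_def neg_power_sqr)
  also have "\<dots> = - infsum ?f odd_pairs" by (rule infsum_uminus)
  finally have o: "infsum ?f odd_pairs = 0" by simp
  have "infsum ?f even_pairs = infsum (\<lambda>x. ?f (case x of (s, t) \<Rightarrow> (s + t, s - t))) UNIV"
    by (rule infsum_reindex_bij_betw[OF bij_even_sum_diff, symmetric])
  also have "\<dots> = (\<Sum>\<^sub>\<infinity>(s,t)\<in>UNIV. (- (q\<^sup>2)) ^ sqr s * (- (q\<^sup>2)) ^ sqr t)"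
  proof (intro infsum_cong, clarify)
    fix s t :: int
    have "q ^ sqr (s + t) * q ^ sqr (s - t) = q ^ (2 * sqr s + 2 * sqr t)"
      by (rule power_mult_same) (simp add: power2_eq_square algebra_simps)
    also have "\<dots> = (q\<^sup>2) ^ sqr s * (q\<^sup>2) ^ sqr t"
      by (simp add: power_add power_mult)
    finally show "q ^ sqr (s + t) * (- q) ^ sqr (s - t) = (- (q\<^sup>2)) ^ sqr s * (- (q\<^sup>2)) ^ sqr t"
      by (auto simp: neg_power_sqr)
  qed
  also have "\<dots> = (phi (- (q\<^sup>2)))\<^sup>2"
    using infsumI[OF qseries_mult[OF admissible_phi admissible_phi q2 q2]]
    by (simp add: phi_def power2_eq_square case_prod_unfold)
  finally show ?thesis
    using qseries_mult_split[OF admissible_phi admissible_phi q, of "- q"] q o by (simp add: phi_def)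
qed

text \<open>
  The even half of the lattice gives \<open>\<phi>(q\<^sup>2)\<^sup>2\<close> and the odd half \<open>q \<psi>(q\<^sup>4)\<^sup>2\<close>; replacing \<open>q\<close> by
  \<open>-q\<close> changes the sign of the odd half.
\<close>

lemma phi_squares:
  assumes q: "norm q < 1"
  shows "(phi q)\<^sup>2 = (phi (q\<^sup>2))\<^sup>2 + q * (psi (q ^ 4))\<^sup>2"
    and "(phi (- q))\<^sup>2 = (phi (q\<^sup>2))\<^sup>2 - q * (psi (q ^ 4))\<^sup>2"
proof -
  have q2: "norm (q\<^sup>2) < 1" "norm (q ^ 4) < 1" "norm (- q) < 1"
    using norm_power_lt_1[OF q, of 2] norm_power_lt_1[OF q, of 4] q by simp_all
  let ?f = "\<lambda>(m, n). q ^ sqr m * q ^ sqr n" and ?g = "\<lambda>(m, n). (- q) ^ sqr m * (- q) ^ sqr n"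
  have "infsum ?f even_pairs = infsum (\<lambda>x. ?f (case x of (s, t) \<Rightarrow> (s + t, s - t))) UNIV"
    by (rule infsum_reindex_bij_betw[OF bij_even_sum_diff, symmetric])
  also have "\<dots> = (\<Sum>\<^sub>\<infinity>(s,t)\<in>UNIV. (q\<^sup>2) ^ sqr s * (q\<^sup>2) ^ sqr t)"
  proof (intro infsum_cong, clarify)
    fix s t :: int
    have "q ^ sqr (s + t) * q ^ sqr (s - t) = q ^ (2 * sqr s + 2 * sqr t)"
      by (rule power_mult_same) (simp add: power2_eq_square algebra_simps)
    then show "q ^ sqr (s + t) * q ^ sqr (s - t) = (q\<^sup>2) ^ sqr s * (q\<^sup>2) ^ sqr t"
      by (simp add: power_add power_mult)
  qed
  also have "\<dots> = (phi (q\<^sup>2))\<^sup>2"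
    using infsumI[OF qseries_mult[OF admissible_phi admissible_phi q2(1) q2(1)]]
    by (simp add: phi_def power2_eq_square case_prod_unfold)
  finally have e: "infsum ?f even_pairs = (phi (q\<^sup>2))\<^sup>2" .
  have "infsum ?f odd_pairs = infsum (\<lambda>x. ?f (case x of (s, t) \<Rightarrow> (s + t + 1, s - t))) UNIV"
    by (rule infsum_reindex_bij_betw[OF bij_odd_sum_diff, symmetric])
  also have "\<dots> = (\<Sum>\<^sub>\<infinity>x. q * (case x of (s,t) \<Rightarrow> (q ^ 4) ^ tri s * (q ^ 4) ^ tri t))"
  proof (intro infsum_cong, clarify)
    fix s t :: int
    have "q ^ sqr (s + t + 1) * q ^ sqr (s - t) = q ^ (1 + 4 * tri s + 4 * tri t)"
      by (rule power_mult_same, insert int_tri[of s] int_tri[of t])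
         (simp add: power2_eq_square algebra_simps)
    then show "q ^ sqr (s + t + 1) * q ^ sqr (s - t) = q * ((q ^ 4) ^ tri s * (q ^ 4) ^ tri t)"
      by (simp add: power_add power_mult)
  qed
  also have "\<dots> = q * (psi (q ^ 4))\<^sup>2"
    using infsumI[OF qseries_mult[OF admissible_psi admissible_psi q2(2) q2(2)]]
    by (simp add: psi_def power2_eq_square infsum_cmult_right')
  finally have o: "infsum ?f odd_pairs = q * (psi (q ^ 4))\<^sup>2" .
  have e': "infsum ?g even_pairs = infsum ?f even_pairs"
    by (rule infsum_cong) (auto simp: even_pairs_def neg_power_sqr)
  have "infsum ?g odd_pairs = infsum (\<lambda>x. - ?f x) odd_pairs"
    by (rule infsum_cong) (auto simp: odd_pairs_def neg_power_sqr)
  also have "\<dots> = - infsum ?f odd_pairs" by (rule infsum_uminus)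
  finally have o': "infsum ?g odd_pairs = - infsum ?f odd_pairs" .
  show "(phi q)\<^sup>2 = (phi (q\<^sup>2))\<^sup>2 + q * (psi (q ^ 4))\<^sup>2"
    using qseries_mult_split[OF admissible_phi admissible_phi q q] e o
    by (simp add: phi_def power2_eq_square)
  show "(phi (- q))\<^sup>2 = (phi (q\<^sup>2))\<^sup>2 - q * (psi (q ^ 4))\<^sup>2"
    using qseries_mult_split[OF admissible_phi admissible_phi q2(3) q2(3)] e o e' o'
    by (simp add: phi_def power2_eq_square)
qed

text \<open>
  Both halves contribute equally, because \<open>n (n + 1)\<close> is invariant under \<open>n \<mapsto> -1 - n\<close>.
\<close>

lemma psi_square:
  assumes q: "norm q < 1"
  shows "(psi q)\<^sup>2 = 2 * phi q * psi (q\<^sup>2)"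
proof -
  have q2: "norm (q\<^sup>2) < 1" using norm_power_lt_1[OF q, of 2] by simp
  let ?f = "\<lambda>(m, n). q ^ tri m * q ^ tri n"
  have sum: "(\<Sum>\<^sub>\<infinity>(s,t)\<in>UNIV. (q\<^sup>2) ^ tri s * q ^ sqr t) = phi q * psi (q\<^sup>2)"
    using infsumI[OF qseries_mult[OF admissible_psi admissible_phi q2 q]]
    by (simp add: phi_def psi_def)
  have "infsum ?f even_pairs = infsum (\<lambda>x. ?f (case x of (s, t) \<Rightarrow> (s + t, s - t))) UNIV"
    by (rule infsum_reindex_bij_betw[OF bij_even_sum_diff, symmetric])
  also have "\<dots> = (\<Sum>\<^sub>\<infinity>(s,t)\<in>UNIV. (q\<^sup>2) ^ tri s * q ^ sqr t)"
  proof (intro infsum_cong, clarify)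
    fix s t :: int
    have "q ^ tri (s + t) * q ^ tri (s - t) = q ^ (2 * tri s + sqr t)"
      by (rule power_mult_same, insert int_tri[of s] int_tri[of "s + t"] int_tri[of "s - t"])
         (simp add: power2_eq_square algebra_simps)
    then show "q ^ tri (s + t) * q ^ tri (s - t) = (q\<^sup>2) ^ tri s * q ^ sqr t"
      by (simp add: power_add power_mult)
  qed
  finally have e: "infsum ?f even_pairs = phi q * psi (q\<^sup>2)" using sum by simp
  have "infsum ?f odd_pairs = infsum (\<lambda>x. ?f (case x of (s, t) \<Rightarrow> (s + t, t - s - 1))) UNIV"
    by (rule infsum_reindex_bij_betw[OF bij_odd_tri, symmetric])
  also have "\<dots> = (\<Sum>\<^sub>\<infinity>(s,t)\<in>UNIV. (q\<^sup>2) ^ tri s * q ^ sqr t)"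
  proof (intro infsum_cong, clarify)
    fix s t :: int
    have "q ^ tri (s + t) * q ^ tri (t - s - 1) = q ^ (2 * tri s + sqr t)"
      by (rule power_mult_same, insert int_tri[of s] int_tri[of "s + t"] int_tri[of "t - s - 1"])
         (simp add: power2_eq_square algebra_simps)
    then show "q ^ tri (s + t) * q ^ tri (t - s - 1) = (q\<^sup>2) ^ tri s * q ^ sqr t"
      by (simp add: power_add power_mult)
  qed
  finally have o: "infsum ?f odd_pairs = phi q * psi (q\<^sup>2)" using sum by simp
  show ?thesis
    using qseries_mult_split[OF admissible_psi admissible_psi q q] e o
    by (simp add: psi_def power2_eq_square)
qed

text \<open>
  This is \<open>\<theta>\<^sub>3(q) \<theta>\<^sub>3(q\<^sup>3) - \<theta>\<^sub>4(q) \<theta>\<^sub>4(q\<^sup>3) = \<theta>\<^sub>2(q) \<theta>\<^sub>2(q\<^sup>3)\<close>, the modular equation of degree 3. The left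
  side is twice the sum over elements \<open>m + n \<surd>-3\<close> of odd norm. The right side runs over the Eisenstein
  integers of odd norm outside \<open>\<int>[\<surd>-3]\<close>. Multiplication by the cube roots of unity permutes all Eisenstein
  integers of odd norm, and every orbit has one member in \<open>\<int>[\<surd>-3]\<close> and two outside.
\<close>

lemma cubic_theta_identity:
  assumes q: "norm q < 1"
  shows "phi q * phi (q ^ 3) - phi (- q) * phi (- (q ^ 3)) = q * psi (q\<^sup>2) * psi (q ^ 6)"
proof -
  have q2: "norm (q\<^sup>2) < 1" "norm (q ^ 3) < 1" "norm (q ^ 6) < 1" "norm (- q) < 1" "norm (- (q ^ 3)) < 1"
    using norm_power_lt_1[OF q, of 2] norm_power_lt_1[OF q, of 3] norm_power_lt_1[OF q, of 6] q
    by simp_all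
  let ?f = "\<lambda>(m, n). q ^ sqr m * (q ^ 3) ^ sqr n" and ?g = "\<lambda>(m, n). (- q) ^ sqr m * (- (q ^ 3)) ^ sqr n"
  let ?h = "\<lambda>(s, t). (q\<^sup>2) ^ tri s * (q ^ 6) ^ tri t"
  have e: "infsum ?g even_pairs = infsum ?f even_pairs"
    by (rule infsum_cong) (auto simp: even_pairs_def neg_power_sqr)
  have "infsum ?g odd_pairs = infsum (\<lambda>x. - ?f x) odd_pairs"
    by (rule infsum_cong) (auto simp: odd_pairs_def neg_power_sqr)
  also have "\<dots> = - infsum ?f odd_pairs" by (rule infsum_uminus)
  finally have o: "infsum ?g odd_pairs = - infsum ?f odd_pairs" .
  have lhs: "phi q * phi (q ^ 3) - phi (- q) * phi (- (q ^ 3)) = 2 * infsum ?f odd_pairs"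
    using qseries_mult_split[OF admissible_phi admissible_phi q q2(2)]
      qseries_mult_split[OF admissible_phi admissible_phi q2(4) q2(5)] e o
    by (simp add: phi_def)
  have "q * infsum ?h odd_pairs = (\<Sum>\<^sub>\<infinity>x\<in>odd_pairs. q * ?h x)"
    by (simp add: infsum_cmult_right')
  also have "\<dots> = (\<Sum>\<^sub>\<infinity>x. q * ?h (case x of (t, k) \<Rightarrow> (2 * k - 1 - t, t)))"
    by (rule infsum_reindex_bij_betw[OF bij_odd_half, symmetric])
  also have "\<dots> = (\<Sum>\<^sub>\<infinity>x. ?f (case x of (t, k) \<Rightarrow> (2 * t - k + 1, - k)))"
  proof (intro infsum_cong, clarify)
    fix t k :: int
    have "q ^ sqr (2 * t - k + 1) * q ^ (3 * sqr (- k)) = q ^ (1 + 2 * tri (2 * k - 1 - t) + 6 * tri t)"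
      by (rule power_mult_same, insert int_tri[of t] int_tri[of "2 * k - 1 - t"])
         (simp add: power2_eq_square algebra_simps)
    then show "q * ((q\<^sup>2) ^ tri (2 * k - 1 - t) * (q ^ 6) ^ tri t) = q ^ sqr (2 * t - k + 1) * (q ^ 3) ^ sqr (- k)"
      by (simp only: power_add power_mult power_one_right mult.assoc)
  qed
  also have "\<dots> = infsum ?f odd_pairs"
    by (rule infsum_reindex_bij_betw[OF bij_odd_omega])
  finally have 1: "q * infsum ?h odd_pairs = infsum ?f odd_pairs" .
  have "q * infsum ?h even_pairs = (\<Sum>\<^sub>\<infinity>x\<in>even_pairs. q * ?h x)"
    by (simp add: infsum_cmult_right')
  also have "\<dots> = (\<Sum>\<^sub>\<infinity>x. q * ?h (case x of (t, k) \<Rightarrow> (2 * k - t, t)))"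
    by (rule infsum_reindex_bij_betw[OF bij_even_half, symmetric])
  also have "\<dots> = (\<Sum>\<^sub>\<infinity>x. ?f (case x of (t, k) \<Rightarrow> (- k - t - 1, k - t)))"
  proof (intro infsum_cong, clarify)
    fix t k :: int
    have "q ^ sqr (- k - t - 1) * q ^ (3 * sqr (k - t)) = q ^ (1 + 2 * tri (2 * k - t) + 6 * tri t)"
      by (rule power_mult_same, insert int_tri[of t] int_tri[of "2 * k - t"])
         (simp add: power2_eq_square algebra_simps)
    then show "q * ((q\<^sup>2) ^ tri (2 * k - t) * (q ^ 6) ^ tri t) = q ^ sqr (- k - t - 1) * (q ^ 3) ^ sqr (k - t)"
      by (simp only: power_add power_mult power_one_right mult.assoc)
  qed
  also have "\<dots> = infsum ?f odd_pairs"
    by (rule infsum_reindex_bij_betw[OF bij_odd_omega'])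
  finally have 2: "q * infsum ?h even_pairs = infsum ?f odd_pairs" .
  have "psi (q\<^sup>2) * psi (q ^ 6) = infsum ?h even_pairs + infsum ?h odd_pairs"
    using qseries_mult_split[OF admissible_psi admissible_psi q2(1) q2(3)] by (simp add: psi_def)
  then show ?thesis using lhs 1 2 by (simp add: algebra_simps)
qed

section \<open>Gauss's infinite product\<close>

definition q_pochhammer :: "complex \<Rightarrow> nat \<Rightarrow> complex" where
  "q_pochhammer q N = (\<Prod>k<N. 1 - q ^ Suc k)"

definition euler :: "complex \<Rightarrow> complex" where
  "euler q = (\<Prod>n. 1 - q ^ Suc n)"

text \<open>
  The Gaussian binomial coefficient, written as a quotient so that its limit can be read off.
\<close>

definition gauss_binomial :: "complex \<Rightarrow> nat \<Rightarrow> nat \<Rightarrow> complex" where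
  "gauss_binomial q M j = q_pochhammer q M / (q_pochhammer q j * q_pochhammer q (M - j))"

lemma one_minus_power_nonzero: "1 - q ^ Suc k \<noteq> 0" if "norm (q :: complex) < 1"
  using norm_power_lt_1[OF that, of "Suc k"] by fastforce

lemma q_pochhammer_nonzero: "q_pochhammer q N \<noteq> 0" if "norm q < 1"
  using one_minus_power_nonzero[OF that] by (auto simp: q_pochhammer_def)

lemma q_pochhammer_0 [simp]: "q_pochhammer q 0 = 1" and q_pochhammer_Suc: "q_pochhammer q (Suc N) = q_pochhammer q N * (1 - q ^ Suc N)"
  by (simp_all add: q_pochhammer_def)

lemma convergent_euler:
  fixes q :: complex
  assumes q: "norm q < 1"
  shows "convergent_prod (\<lambda>n. 1 - q ^ Suc n)"
proof (rule abs_convergent_prod_imp_convergent_prod)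
  have "summable (\<lambda>n. norm q * norm q ^ n)"
    using q by (intro summable_mult) (simp add: summable_geometric)
  then show "abs_convergent_prod (\<lambda>n. 1 - q ^ Suc n)"
    by (simp add: abs_convergent_prod_conv_summable norm_mult norm_power)
qed

lemma q_pochhammer_tendsto: "q_pochhammer q \<longlonglongrightarrow> euler q" if "norm q < 1"
proof -
  have "(\<lambda>n. \<Prod>k\<le>n. 1 - q ^ Suc k) \<longlonglongrightarrow> euler q"
    unfolding euler_def by (rule convergent_prod_LIMSEQ[OF convergent_euler[OF that]])
  then have "(\<lambda>n. q_pochhammer q (Suc n)) \<longlonglongrightarrow> euler q"
    by (simp add: q_pochhammer_def lessThan_Suc_atMost)
  then show ?thesis by (rule LIMSEQ_imp_Suc)
qed

lemma euler_nonzero: "euler q \<noteq> 0" if "norm q < 1"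
  unfolding euler_def
  by (rule prodinf_nonzero[OF convergent_euler[OF that]]) (use one_minus_power_nonzero[OF that] in blast)

lemma gauss_binomial_pascal:
  assumes q: "norm q < 1" and "j < M"
  shows "gauss_binomial q (Suc M) (Suc j) = gauss_binomial q M (Suc j) + q ^ (M - j) * gauss_binomial q M j"
proof -
  obtain d where d: "M = Suc (j + d)" using \<open>j < M\<close> less_imp_Suc_add by blast
  have nz: "q_pochhammer q j \<noteq> 0" "q_pochhammer q d \<noteq> 0" "1 - q ^ Suc j \<noteq> 0" "1 - q ^ Suc d \<noteq> 0"
    using q_pochhammer_nonzero[OF q] one_minus_power_nonzero[OF q] by blast+
  have e: "1 - q ^ Suc M = (1 - q ^ Suc d) + q ^ Suc d * (1 - q ^ Suc j)"
    by (simp add: d power_add algebra_simps)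
  have gen: "A * (v + V * u) / (B * u * (C * v)) = A / (B * u * C) + V * (A / (B * (C * v)))"
    if "B \<noteq> 0" "C \<noteq> 0" "u \<noteq> 0" "v \<noteq> 0" for A B C u v V :: complex
    using that by (simp add: field_simps)
  have d': "M - Suc j = d" "M - j = Suc d" using d by auto
  have "gauss_binomial q (Suc M) (Suc j) =
      q_pochhammer q M * ((1 - q ^ Suc d) + q ^ Suc d * (1 - q ^ Suc j)) /
        (q_pochhammer q j * (1 - q ^ Suc j) * (q_pochhammer q d * (1 - q ^ Suc d)))"
    by (simp only: gauss_binomial_def diff_Suc_Suc d' q_pochhammer_Suc e)
  also have "\<dots> = q_pochhammer q M / (q_pochhammer q j * (1 - q ^ Suc j) * q_pochhammer q d) +
      q ^ Suc d * (q_pochhammer q M / (q_pochhammer q j * (q_pochhammer q d * (1 - q ^ Suc d))))"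
    using nz by (intro gen)
  finally show ?thesis by (simp only: gauss_binomial_def d' q_pochhammer_Suc)
qed

lemma gauss_binomial_0 [simp]: "norm q < 1 \<Longrightarrow> gauss_binomial q M 0 = 1" and gauss_binomial_self [simp]: "norm q < 1 \<Longrightarrow> gauss_binomial q M M = 1"
  using q_pochhammer_nonzero[of q M] by (simp_all add: gauss_binomial_def)

lemma q_binomial_theorem:
  assumes q: "norm q < 1"
  shows "(\<Prod>k<M. 1 + y * q ^ k) = (\<Sum>j\<le>M. gauss_binomial q M j * q ^ (j choose 2) * y ^ j)"
proof (induction M)
  case 0
  then show ?case using q by (simp add: binomial_eq_0)
next
  case (Suc M)
  let ?c = "\<lambda>M j. gauss_binomial q M j * q ^ (j choose 2) * y ^ j"
  have ch: "Suc j choose 2 = (j choose 2) + j" for j by (simp add: numeral_2_eq_2)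
  have step: "?c (Suc M) (Suc j) = ?c M (Suc j) + y * q ^ M * ?c M j" if "j < M" for j
  proof -
    have "q ^ (M - j) * q ^ j = q ^ M" using that by (simp flip: power_add)
    then have "q ^ (M - j) * q ^ (Suc j choose 2) = q ^ M * q ^ (j choose 2)"
      by (simp add: ch power_add algebra_simps)
    moreover have "?c (Suc M) (Suc j) = ?c M (Suc j) + (q ^ (M - j) * q ^ (Suc j choose 2)) * gauss_binomial q M j * y ^ Suc j"
      by (simp add: gauss_binomial_pascal[OF q that] algebra_simps)
    ultimately show ?thesis by (simp add: algebra_simps)
  qed
  have S: "(\<Sum>j<M. ?c (Suc M) (Suc j)) = (\<Sum>j<M. ?c M (Suc j)) + y * q ^ M * (\<Sum>j<M. ?c M j)"
    unfolding sum_distrib_left sum.distrib[symmetric] by (rule sum.cong) (use step in auto)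
  have last: "?c (Suc M) (Suc M) = y * q ^ M * ?c M M"
    using q by (simp add: ch power_add algebra_simps)
  have "(\<Sum>j\<le>Suc M. ?c (Suc M) j) = ?c (Suc M) 0 + (\<Sum>j<M. ?c (Suc M) (Suc j)) + ?c (Suc M) (Suc M)"
    unfolding sum.atMost_Suc_shift[of _ M] lessThan_Suc_atMost[symmetric, of M] sum.lessThan_Suc
    by (simp only: add.assoc)
  also have "\<dots> = ?c M 0 + (\<Sum>j<M. ?c M (Suc j)) + y * q ^ M * ((\<Sum>j<M. ?c M j) + ?c M M)"
    using q by (simp only: last S) (simp add: algebra_simps)
  also have "\<dots> = (\<Sum>j\<le>M. ?c M j) + y * q ^ M * (\<Sum>j\<le>M. ?c M j)"
    by (simp only: lessThan_Suc_atMost[symmetric] sum.lessThan_Suc)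
       (subst sum.lessThan_Suc_shift[symmetric], simp)
  finally show ?case using Suc.IH by (simp add: algebra_simps)
qed

lemma sum_upto_double_eq_halves:
  fixes f :: "nat \<Rightarrow> 'a::comm_monoid_add"
  shows "(\<Sum>j\<le>2 * N. f j) = (\<Sum>n\<le>N. f (N + n)) + (\<Sum>n<N. f (N - Suc n))"
proof -
  have "{..2 * N} = {..<N} \<union> {N..N + N}" by auto
  moreover have "sum f ({..<N} \<union> {N..N + N}) = sum f {..<N} + sum f {N..N + N}"
    by (rule sum.union_disjoint) auto
  ultimately have "(\<Sum>j\<le>2 * N. f j) = (\<Sum>j<N. f j) + (\<Sum>j\<in>{N..N + N}. f j)"
    by simp
  moreover have "(\<Sum>j\<in>{N..N + N}. f j) = (\<Sum>n\<le>N. f (N + n))"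
    using sum.atLeastAtMost_shift_0[of N "N + N" f] by (simp add: atLeast0AtMost add.commute)
  moreover have "(\<Sum>j<N. f j) = (\<Sum>n<N. f (N - Suc n))"
    by (rule sum.nat_diff_reindex[symmetric])
  ultimately show ?thesis by (simp add: add.commute)
qed

lemma prod_lessThan_add:
  fixes f :: "nat \<Rightarrow> 'a::comm_monoid_mult"
  shows "(\<Prod>k<N + M. f k) = (\<Prod>k<N. f k) * (\<Prod>k<M. f (N + k))"
  by (induction M) (simp_all add: mult_ac)

text \<open>
  The \<open>q\<close>-binomial theorem to the base \<open>q\<^sup>2\<close> with \<open>2 N\<close> factors, at the point where the factors
  \<open>1 - q ^ (2 i + 1)\<close> and \<open>1 - q ^ (- (2 i + 1))\<close> occur in pairs. Completing the square in the exponent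
  centres the sum at \<open>j = N\<close>.
\<close>

lemma finite_gauss_identity:
  assumes q: "norm q < 1" "q \<noteq> 0"
  shows "(\<Prod>i<N. 1 - q ^ (2 * i + 1))\<^sup>2 =
     (\<Sum>n\<le>N. gauss_binomial (q\<^sup>2) (2 * N) (N + n) * (- q) ^ sqr (int n)) +
     (\<Sum>n<N. gauss_binomial (q\<^sup>2) (2 * N) (N - Suc n) * (- q) ^ sqr (-1 - int n))"
proof -
  \<comment> \<open>This makes the exponents run through the odd numbers from \<open>1 - 2 N\<close> to \<open>2 N - 1\<close>.\<close>
  define y where "y = - (q / q ^ (2 * N))"
  have q2: "norm (q\<^sup>2) < 1" using norm_power_lt_1[OF q(1), of 2] by simp
  have odds: "(\<Prod>i<N. q ^ (2 * i + 1)) = q ^ (N\<^sup>2)"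
    by (induction N) (simp_all add: power2_eq_square power_add mult_2 mult_2_right algebra_simps)
  have "(\<Prod>k<2 * N. 1 + y * (q\<^sup>2) ^ k) = (\<Prod>k<N. 1 + y * (q\<^sup>2) ^ k) * (\<Prod>k<N. 1 + y * (q\<^sup>2) ^ (N + k))"
    unfolding mult_2 by (rule prod_lessThan_add)
  also have "(\<Prod>k<N. 1 + y * (q\<^sup>2) ^ (N + k)) = (\<Prod>k<N. 1 - q ^ (2 * k + 1))"
  proof (intro prod.cong refl)
    fix k
    have "(q\<^sup>2) ^ (N + k) = q ^ (2 * N) * q ^ (2 * k)"
      by (simp add: power_add power_mult)
    then show "1 + y * (q\<^sup>2) ^ (N + k) = 1 - q ^ (2 * k + 1)"
      using q by (simp add: y_def)
  qed
  also have "(\<Prod>k<N. 1 + y * (q\<^sup>2) ^ k) = (\<Prod>i<N. 1 + y * (q\<^sup>2) ^ (N - Suc i))"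
    by (rule prod.nat_diff_reindex[symmetric])
  also have "\<dots> = (\<Prod>i<N. - (1 - q ^ (2 * i + 1)) / q ^ (2 * i + 1))"
  proof (intro prod.cong refl)
    fix i assume "i \<in> {..<N}"
    then have "q * (q\<^sup>2) ^ (N - Suc i) * q ^ (2 * i + 1) = q ^ (1 + 2 * (N - Suc i) + (2 * i + 1))"
      by (simp only: power_add power_mult power_one_right)
    also have "1 + 2 * (N - Suc i) + (2 * i + 1) = 2 * N" using \<open>i \<in> {..<N}\<close> by simp
    finally have "q * (q\<^sup>2) ^ (N - Suc i) * q ^ (2 * i + 1) = q ^ (2 * N)" .
    then have "q * (q\<^sup>2) ^ (N - Suc i) / q ^ (2 * N) = 1 / q ^ (2 * i + 1)"
      using q by (simp add: frac_eq_eq del: power_Suc)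
    then have "y * (q\<^sup>2) ^ (N - Suc i) = - (1 / q ^ (2 * i + 1))"
      by (simp add: y_def)
    then show "1 + y * (q\<^sup>2) ^ (N - Suc i) = - (1 - q ^ (2 * i + 1)) / q ^ (2 * i + 1)"
      using q by (simp add: diff_divide_distrib)
  qed
  also have "\<dots> = (- 1) ^ N * (\<Prod>i<N. 1 - q ^ (2 * i + 1)) / q ^ (N\<^sup>2)"
    unfolding prod_dividef odds prod_uminus by simp
  finally have "(\<Prod>i<N. 1 - q ^ (2 * i + 1))\<^sup>2 = (- 1) ^ N * q ^ (N\<^sup>2) * (\<Prod>k<2 * N. 1 + y * (q\<^sup>2) ^ k)"
    using q by (simp add: power2_eq_square[of "\<Prod>i<N. 1 - q * q ^ (2 * i)"])
  also have "\<dots> = (\<Sum>j\<le>2 * N. gauss_binomial (q\<^sup>2) (2 * N) j * (- q) ^ sqr (int j - int N))"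
    unfolding q_binomial_theorem[OF q2] sum_distrib_left
  proof (intro sum.cong refl)
    fix j
    have e: "q ^ (N\<^sup>2) * (q\<^sup>2) ^ (j choose 2) * q ^ j = q ^ sqr (int j - int N) * q ^ (2 * N * j)"
    proof -
      have "2 * (j choose 2) + j = j\<^sup>2"
        by (induction j) (simp_all add: numeral_2_eq_2 power2_eq_square)
      then have "int (N\<^sup>2) + (2 * int (j choose 2) + int j) = int (sqr (int j - int N)) + int (2 * N * j)"
        by (simp add: power2_eq_square algebra_simps flip: of_nat_add of_nat_mult)
      then have "N\<^sup>2 + (2 * (j choose 2) + j) = sqr (int j - int N) + 2 * N * j" by linarith
      then show ?thesis by (metis power_add power_mult mult.assoc)
    qed
    have s: "(- 1) ^ N * (- 1) ^ j * q ^ sqr (int j - int N) = (- q) ^ sqr (int j - int N)"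
      by (auto simp: neg_power_sqr)
    have "y ^ j = (- 1) ^ j * (q / q ^ (2 * N)) ^ j"
      unfolding y_def by (rule power_minus)
    also have "(q / q ^ (2 * N)) ^ j = q ^ j / q ^ (2 * N * j)"
      by (simp only: power_divide power_mult)
    finally have "y ^ j = (- 1) ^ j * q ^ j / q ^ (2 * N * j)" by simp
    then have "(- 1) ^ N * q ^ (N\<^sup>2) * (gauss_binomial (q\<^sup>2) (2 * N) j * (q\<^sup>2) ^ (j choose 2) * y ^ j)
      = (- 1) ^ N * (- 1) ^ j * gauss_binomial (q\<^sup>2) (2 * N) j * (q ^ (N\<^sup>2) * (q\<^sup>2) ^ (j choose 2) * q ^ j) / q ^ (2 * N * j)"
      by simp
    also have "\<dots> = gauss_binomial (q\<^sup>2) (2 * N) j * ((- 1) ^ N * (- 1) ^ j * q ^ sqr (int j - int N))"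
      unfolding e using q by simp
    finally show "(- 1) ^ N * q ^ (N\<^sup>2) * (gauss_binomial (q\<^sup>2) (2 * N) j * (q\<^sup>2) ^ (j choose 2) * y ^ j)
      = gauss_binomial (q\<^sup>2) (2 * N) j * (- q) ^ sqr (int j - int N)" unfolding s .
  qed
  also have "\<dots> = (\<Sum>n\<le>N. gauss_binomial (q\<^sup>2) (2 * N) (N + n) * (- q) ^ sqr (int n)) +
     (\<Sum>n<N. gauss_binomial (q\<^sup>2) (2 * N) (N - Suc n) * (- q) ^ sqr (-1 - int n))"
    unfolding sum_upto_double_eq_halves
    by (intro arg_cong2[where f = "(+)"] sum.cong) (auto simp: of_nat_diff algebra_simps)
  finally show ?thesis .
qed

lemma gauss_binomial_bounded:
  assumes q: "norm q < 1"
  obtains C where "C \<ge> 0" "\<And>M j. norm (gauss_binomial q M j) \<le> C"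
proof -
  have "Bseq (q_pochhammer q)"
    using q_pochhammer_tendsto[OF q] by (blast intro: convergent_imp_Bseq convergentI)
  then obtain A where A: "A > 0" "\<And>n. norm (q_pochhammer q n) \<le> A" by (rule BseqE) blast
  have "(\<lambda>n. inverse (q_pochhammer q n)) \<longlonglongrightarrow> inverse (euler q)"
    by (rule tendsto_inverse[OF q_pochhammer_tendsto[OF q] euler_nonzero[OF q]])
  then have "Bseq (\<lambda>n. inverse (q_pochhammer q n))"
    by (blast intro: convergent_imp_Bseq convergentI)
  then obtain B where B: "B > 0" "\<And>n. norm (inverse (q_pochhammer q n)) \<le> B" by (rule BseqE) blast
  have "norm (gauss_binomial q M j) \<le> A * (B * B)" for M j
  proof -
    have "norm (gauss_binomial q M j) = norm (q_pochhammer q M) * (norm (inverse (q_pochhammer q j)) * norm (inverse (q_pochhammer q (M - j))))"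
      by (simp add: gauss_binomial_def norm_divide norm_mult norm_inverse field_simps)
    also have "\<dots> \<le> A * (B * B)"
      by (intro mult_mono A B) (use A B in auto)
    finally show ?thesis .
  qed
  then show ?thesis using that[of "A * (B * B)"] A B by auto
qed

text \<open>
  The limit \<open>N \<rightarrow> \<infinity>\<close> of the finite identity: each Gaussian binomial coefficient tends to the inverse of
  \<open>euler (q\<^sup>2)\<close>, and the coefficients are uniformly bounded, so that Tannery's theorem applies.
\<close>

theorem gauss_theta_product:
  assumes q: "norm q < 1"
  shows "phi (- q) * euler (q\<^sup>2) = (euler q)\<^sup>2"
proof (cases "q = 0")
  case True
  then show ?thesis by (simp add: phi_0 euler_def)
next
  case q0: False
  have q2: "norm (q\<^sup>2) < 1" using norm_power_lt_1[OF q, of 2] by simp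
  define P where "P = euler (q\<^sup>2)"
  have P: "P \<noteq> 0" using euler_nonzero[OF q2] by (simp add: P_def)
  have lim_add: "(\<lambda>N. q_pochhammer (q\<^sup>2) (2 * N)) \<longlonglongrightarrow> P" "(\<lambda>N. q_pochhammer (q\<^sup>2) (N + n)) \<longlonglongrightarrow> P"
       "(\<lambda>N. q_pochhammer (q\<^sup>2) (N - n)) \<longlonglongrightarrow> P" for n
    unfolding P_def
    by (rule filterlim_compose[OF q_pochhammer_tendsto[OF q2]]; rule mult_nat_left_at_top filterlim_minus_const_nat_at_top filterlim_add_const_nat_at_top; simp)+
  obtain C where C: "C \<ge> 0" "\<And>M j. norm (gauss_binomial (q\<^sup>2) M j) \<le> C" using gauss_binomial_bounded[OF q2] by blast
  define b where "b = (\<lambda>n N. if n \<le> N then gauss_binomial (q\<^sup>2) (2 * N) (N + n) else 0)"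
  define c where "c = (\<lambda>n N. if n < N then gauss_binomial (q\<^sup>2) (2 * N) (N - Suc n) else 0)"
  define a where "a = (\<lambda>n N. b n N * (- q) ^ sqr (int n) + c n N * (- q) ^ sqr (-1 - int n))"
  have quot: "(\<lambda>N. q_pochhammer (q\<^sup>2) (2 * N) / (q_pochhammer (q\<^sup>2) (N + n) * q_pochhammer (q\<^sup>2) (N - n))) \<longlonglongrightarrow> 1 / P" for n
  proof -
    have "(\<lambda>N. q_pochhammer (q\<^sup>2) (2 * N) / (q_pochhammer (q\<^sup>2) (N + n) * q_pochhammer (q\<^sup>2) (N - n))) \<longlonglongrightarrow> P / (P * P)"
      by (intro tendsto_intros lim_add) (use P in auto)
    then show ?thesis using P by simp
  qed
  have b: "b n \<longlonglongrightarrow> 1 / P" for n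
  proof (rule Lim_transform_eventually[OF quot])
    show "\<forall>\<^sub>F N in sequentially. q_pochhammer (q\<^sup>2) (2 * N) / (q_pochhammer (q\<^sup>2) (N + n) * q_pochhammer (q\<^sup>2) (N - n)) = b n N"
      using eventually_ge_at_top[of n] by eventually_elim (simp add: b_def gauss_binomial_def mult_2)
  qed
  have c: "c n \<longlonglongrightarrow> 1 / P" for n
  proof (rule Lim_transform_eventually[OF quot])
    show "\<forall>\<^sub>F N in sequentially. q_pochhammer (q\<^sup>2) (2 * N) / (q_pochhammer (q\<^sup>2) (N + Suc n) * q_pochhammer (q\<^sup>2) (N - Suc n)) = c n N"
      using eventually_gt_at_top[of n]
      by eventually_elim (auto simp: c_def gauss_binomial_def mult_2 mult.commute intro!: arg_cong2[where f = "(/)"] arg_cong2[where f = "(*)"] arg_cong[where f = "q_pochhammer (q\<^sup>2)"])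
  qed
  have halves: "int n \<le> int (sqr (int n))" "int n \<le> int (sqr (-1 - int n))" for n
    using admissible_phi unfolding admissible_def of_nat_le_iff by blast+
  have pw: "norm ((- q) ^ k) \<le> norm q ^ n" if "int n \<le> int k" for n k
    using that q by (simp add: norm_power power_decreasing)
  have bound: "norm (a n N) \<le> 2 * C * norm q ^ n" for n N
  proof -
    have "norm (b n N) \<le> C" "norm (c n N) \<le> C" using C by (auto simp: b_def c_def)
    then have "norm (b n N * (- q) ^ sqr (int n)) \<le> C * norm q ^ n"
        "norm (c n N * (- q) ^ sqr (-1 - int n)) \<le> C * norm q ^ n"
      unfolding norm_mult by (intro mult_mono pw halves; use C in auto)+
    from norm_triangle_mono[OF this] show ?thesis unfolding a_def by simp
  qed
  have "(\<lambda>N. \<Sum>n. a n N) \<longlonglongrightarrow> (\<Sum>n. 1 / P * (- q) ^ sqr (int n) + 1 / P * (- q) ^ sqr (-1 - int n))"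
  proof (rule tannerys_theorem[THEN conjunct2, THEN conjunct2])
    show "a n \<longlonglongrightarrow> 1 / P * (- q) ^ sqr (int n) + 1 / P * (- q) ^ sqr (-1 - int n)" for n
      unfolding a_def by (intro tendsto_intros b c)
    show "summable (\<lambda>n. 2 * C * norm q ^ n)"
      using q by (intro summable_mult) (simp add: summable_geometric)
    show "\<forall>\<^sub>F (n, N) in sequentially \<times>\<^sub>F sequentially. norm (a n N) \<le> 2 * C * norm q ^ n"
      using bound by (intro always_eventually) auto
  qed simp
  also have "(\<Sum>n. 1 / P * (- q) ^ sqr (int n) + 1 / P * (- q) ^ sqr (-1 - int n)) = 1 / P * phi (- q)"
  proof -
    have "summable (\<lambda>n. (- q) ^ sqr (int n) + (- q) ^ sqr (-1 - int n))"
    proof (rule summable_comparison_test)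
      have "norm ((- q) ^ sqr (int n) + (- q) ^ sqr (-1 - int n)) \<le> 2 * norm q ^ n" for n
        using norm_triangle_mono[OF pw[OF halves(1)[of n]] pw[OF halves(2)[of n]]] by simp
      then show "\<exists>N. \<forall>n\<ge>N. norm ((- q) ^ sqr (int n) + (- q) ^ sqr (-1 - int n)) \<le> 2 * norm q ^ n"
        by blast
      show "summable (\<lambda>n. 2 * norm q ^ n)"
        using q by (intro summable_mult) (simp add: summable_geometric)
    qed
    then show ?thesis
      unfolding distrib_left[symmetric]
      by (subst suminf_mult) (simp_all add: phi_def qseries_halves(2)[OF admissible_phi] q)
  qed
  finally have lim1: "(\<lambda>N. \<Sum>n. a n N) \<longlonglongrightarrow> 1 / P * phi (- q)" .
  have "(\<Sum>n. a n N) = (q_pochhammer q (2 * N) / q_pochhammer (q\<^sup>2) N)\<^sup>2" for N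
  proof -
    have "(\<Sum>n. a n N) = (\<Sum>n\<le>N. a n N)"
      by (rule suminf_finite) (auto simp: a_def b_def c_def)
    also have "\<dots> = (\<Sum>n\<le>N. b n N * (- q) ^ sqr (int n)) + (\<Sum>n\<le>N. c n N * (- q) ^ sqr (-1 - int n))"
      by (simp add: a_def sum.distrib)
    also have "(\<Sum>n\<le>N. c n N * (- q) ^ sqr (-1 - int n)) = (\<Sum>n<N. c n N * (- q) ^ sqr (-1 - int n))"
      by (rule sum.mono_neutral_right) (auto simp: c_def)
    also have "(\<Sum>n\<le>N. b n N * (- q) ^ sqr (int n)) + (\<Sum>n<N. c n N * (- q) ^ sqr (-1 - int n)) =
        (\<Prod>i<N. 1 - q ^ (2 * i + 1))\<^sup>2"
      unfolding finite_gauss_identity[OF q q0]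
      by (intro arg_cong2[where f = "(+)"] sum.cong) (auto simp: b_def c_def)
    also have "(\<Prod>i<N. 1 - q ^ (2 * i + 1)) * q_pochhammer (q\<^sup>2) N = q_pochhammer q (2 * N)"
    proof (induction N)
      case (Suc N)
      have "(q\<^sup>2) ^ Suc N = q ^ Suc (Suc (2 * N))" by (simp add: power_mult power2_eq_square)
      then have "(\<Prod>i<Suc N. 1 - q ^ (2 * i + 1)) * q_pochhammer (q\<^sup>2) (Suc N) =
          ((\<Prod>i<N. 1 - q ^ (2 * i + 1)) * q_pochhammer (q\<^sup>2) N) * (1 - q ^ Suc (2 * N)) * (1 - q ^ Suc (Suc (2 * N)))"
        by (simp only: q_pochhammer_Suc prod.lessThan_Suc) simp
      also have "\<dots> = q_pochhammer q (Suc (Suc (2 * N)))"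
        by (simp only: Suc.IH q_pochhammer_Suc)
      finally show ?case by simp
    qed simp
    then have "(\<Prod>i<N. 1 - q ^ (2 * i + 1)) = q_pochhammer q (2 * N) / q_pochhammer (q\<^sup>2) N"
      using q_pochhammer_nonzero[OF q2] by (simp add: field_simps)
    finally show ?thesis .
  qed
  moreover have "(\<lambda>N. (q_pochhammer q (2 * N) / q_pochhammer (q\<^sup>2) N)\<^sup>2) \<longlonglongrightarrow> (euler q / P)\<^sup>2"
  proof (intro tendsto_intros)
    show "(\<lambda>N. q_pochhammer q (2 * N)) \<longlonglongrightarrow> euler q"
      by (rule filterlim_compose[OF q_pochhammer_tendsto[OF q]]) (rule mult_nat_left_at_top, simp)
    show "q_pochhammer (q\<^sup>2) \<longlonglongrightarrow> P" unfolding P_def by (rule q_pochhammer_tendsto[OF q2])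
  qed (use P in auto)
  ultimately have "1 / P * phi (- q) = (euler q / P)\<^sup>2"
    using LIMSEQ_unique[OF lim1] by simp
  then show ?thesis
    using P unfolding P_def[symmetric] by (simp add: field_simps power2_eq_square[of P] power2_eq_square[of "euler q"])
qed

section \<open>Landen's transformation and the differential equations\<close>

lemma power_two_power_tendsto_0:
  assumes q: "norm (q :: complex) < 1"
  shows "(\<lambda>n. q ^ (2 ^ n)) \<longlonglongrightarrow> 0"
  using LIMSEQ_subseq_LIMSEQ[OF LIMSEQ_power_zero[OF q], of "\<lambda>n. 2 ^ n"]
  by (simp add: o_def strict_mono_def)

text \<open>
  Iterating \<open>q \<mapsto> q\<^sup>2\<close> drives every point of the unit disc to the centre, so a functional equation under
  squaring reduces a global identity to the behaviour at \<open>0\<close>.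
\<close>

lemma squaring_invariant_imp_constant:
  fixes h :: "complex \<Rightarrow> complex"
  assumes inv: "\<And>q. norm q < 1 \<Longrightarrow> h (q\<^sup>2) = h q" and cont: "isCont h 0" and q: "norm q < 1"
  shows "h q = h 0"
proof -
  have "h (q ^ (2 ^ n)) = h q" for n
  proof (induction n)
    case (Suc n)
    have "h ((q ^ (2 ^ n))\<^sup>2) = h (q ^ (2 ^ n))"
      by (rule inv) (use q norm_power_lt_1[of q "2 ^ n"] in simp)
    then show ?case using Suc by (simp add: power_mult[symmetric] mult.commute)
  qed simp
  then have "(\<lambda>n. h q) \<longlonglongrightarrow> h 0"
    using isCont_tendsto_compose[OF cont power_two_power_tendsto_0[OF q]] by simp
  then show ?thesis by (simp add: LIMSEQ_const_iff)
qed

text \<open>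
  For small \<open>q\<close> the factor \<open>4 q\<close> is a contraction, which forces \<open>f\<close> to vanish near the origin; the equation
  then carries the zeros outwards.
\<close>

lemma squaring_contraction_imp_zero:
  fixes f :: "complex \<Rightarrow> complex"
  assumes eq: "\<And>q. norm q < 1 \<Longrightarrow> q \<noteq> 0 \<Longrightarrow> f q = 4 * q * f (q\<^sup>2)"
    and cont: "continuous_on (ball 0 1) f" and q: "norm q < 1" "q \<noteq> 0"
  shows "f q = 0"
proof -
  have "continuous_on (cball 0 (1/8)) f"
    by (rule continuous_on_subset[OF cont]) auto
  then have "compact (f ` cball 0 (1/8))" by (rule compact_continuous_image) simp
  then obtain K where K: "\<And>z. norm z \<le> 1/8 \<Longrightarrow> norm (f z) \<le> K"
    by (meson bounded_iff compact_imp_bounded image_eqI mem_cball_0)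
  have small: "norm (f z) \<le> K / 2 ^ n" if "norm z \<le> 1/8" "z \<noteq> 0" for z n
    using that
  proof (induction n arbitrary: z)
    case (Suc n)
    have n2: "norm (z\<^sup>2) \<le> 1/8"
      using mult_mono[of "norm z" "1/8" "norm z" 1] Suc.prems by (simp add: norm_power norm_mult power2_eq_square)
    have "norm (f z) = 4 * norm z * norm (f (z\<^sup>2))"
      using eq[of z] Suc.prems by (simp add: norm_mult)
    also have "\<dots> \<le> 4 * (1/8) * (K / 2 ^ n)"
      by (intro mult_mono Suc.IH n2) (use Suc.prems in auto)
    finally show ?case by simp
  qed (use K in simp)
  have zero: "f z = 0" if "norm z \<le> 1/8" "z \<noteq> 0" for z
  proof -
    have "(\<lambda>n. K / 2 ^ n) \<longlonglongrightarrow> 0" by real_asymp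
    then have "norm (f z) \<le> 0"
      by (rule LIMSEQ_le_const) (use small[OF that] in auto)
    then show ?thesis by simp
  qed
  show ?thesis
  proof (rule ccontr)
    assume nz: "f q \<noteq> 0"
    have all: "f (q ^ (2 ^ n)) \<noteq> 0" for n
    proof (induction n)
      case (Suc n)
      have "norm (q ^ (2 ^ n)) < 1" using q norm_power_lt_1[of q "2 ^ n"] by simp
      with Suc eq[of "q ^ (2 ^ n)"] q have "f ((q ^ (2 ^ n))\<^sup>2) \<noteq> 0" by auto
      then show ?case by (simp add: power_mult[symmetric] mult.commute)
    qed (use nz in simp)
    have "eventually (\<lambda>n. norm (q ^ (2 ^ n)) < 1/8) sequentially"
      using tendsto_norm_zero[OF power_two_power_tendsto_0[OF q(1)]] by (rule order_tendstoD) simp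
    then obtain n where "norm (q ^ (2 ^ n)) < 1/8" by (auto simp: eventually_sequentially)
    then show False using zero[of "q ^ (2 ^ n)"] all[of n] q by simp
  qed
qed

lemma isCont_phi: "isCont phi q" and isCont_psi: "isCont psi q" if "norm q < 1"
  using holomorphic_on_imp_continuous_on[OF holomorphic_phi] holomorphic_on_imp_continuous_on[OF holomorphic_psi] that
  by (auto simp: continuous_on_eq_continuous_at)

text \<open>
  A zero would give zeros at the points \<open>- (q ^ (2 ^ n))\<close>, which tend to \<open>0\<close>, while \<open>phi 0 = 1\<close>.
\<close>

lemma phi_nonzero:
  assumes q: "norm q < 1"
  shows "phi q \<noteq> 0"
proof
  assume 0: "phi q = 0"
  have "phi (- (q ^ (2 ^ Suc n))) = 0" for n
  proof (induction n)
    case 0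
    then show ?case using phi_mult_phi_neg[OF q] \<open>phi q = 0\<close> by simp
  next
    case (Suc n)
    have "norm (q ^ (2 ^ Suc n)) < 1" by (rule norm_power_lt_1[OF q]) simp
    then have "phi (- (q ^ (2 ^ Suc n))) * phi (- (- (q ^ (2 ^ Suc n)))) = (phi (- ((- (q ^ (2 ^ Suc n)))\<^sup>2)))\<^sup>2"
      by (intro phi_mult_phi_neg) simp
    moreover have "(- (q ^ (2 ^ Suc n)))\<^sup>2 = q ^ (2 ^ Suc (Suc n))"
      by (simp add: power_mult[symmetric] mult.commute)
    ultimately show ?case using Suc by simp
  qed
  moreover have "(\<lambda>n. phi (- (q ^ (2 ^ Suc n)))) \<longlonglongrightarrow> phi (- 0)"
    by (rule isCont_tendsto_compose[where g = phi], rule isCont_phi, simp,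
        rule tendsto_minus, rule LIMSEQ_Suc[OF power_two_power_tendsto_0[OF q]])
  ultimately show False by (simp add: LIMSEQ_const_iff phi_0)
qed

lemma psi_nonzero:
  assumes q: "norm q < 1"
  shows "psi q \<noteq> 0"
proof
  assume 0: "psi q = 0"
  have "psi (q ^ (2 ^ n)) = 0" for n
  proof (induction n)
    case (Suc n)
    have "norm (q ^ (2 ^ n)) < 1" by (rule norm_power_lt_1[OF q]) simp
    from psi_square[OF this] phi_nonzero[OF this] Suc
    have "psi ((q ^ (2 ^ n))\<^sup>2) = 0" by simp
    then show ?case by (simp add: power_mult[symmetric] mult.commute)
  qed (use 0 in simp)
  moreover have "(\<lambda>n. psi (q ^ (2 ^ n))) \<longlonglongrightarrow> psi 0"
    by (rule isCont_tendsto_compose[where g = psi], rule isCont_psi, simp,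
        rule power_two_power_tendsto_0[OF q])
  ultimately show False by (simp add: LIMSEQ_const_iff psi_0)
qed

text \<open>
  Jacobi's \<open>\<theta>\<^sub>3\<^sup>4 - \<theta>\<^sub>4\<^sup>4 = \<theta>\<^sub>2\<^sup>4\<close>.
\<close>

lemma phi_quartic:
  assumes q: "norm q < 1"
  shows "phi q ^ 4 - phi (- q) ^ 4 = q * psi (q\<^sup>2) ^ 4"
proof -
  have q2: "norm (q\<^sup>2) < 1" using norm_power_lt_1[OF q, of 2] by simp
  have p: "(psi (q\<^sup>2))\<^sup>2 = 2 * phi (q\<^sup>2) * psi (q ^ 4)"
    using psi_square[OF q2] by (simp add: power_mult[symmetric])
  have sq: "x ^ 4 = (x\<^sup>2)\<^sup>2" for x :: complex by simp
  show ?thesis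
    unfolding sq[of "phi q"] sq[of "phi (- q)"] sq[of "psi (q\<^sup>2)"] p phi_squares[OF q]
    by (simp add: power2_eq_square algebra_simps)
qed

definition logderiv_phi :: "complex \<Rightarrow> complex" where
  "logderiv_phi q = deriv phi q / phi q"

lemma DERIV_phi [derivative_intros]:
  assumes "(f has_field_derivative f') (at q)" "norm (f q) < 1"
  shows "((\<lambda>q. phi (f q)) has_field_derivative deriv phi (f q) * f') (at q)"
  by (rule DERIV_chain2[OF holomorphic_derivI[OF holomorphic_phi open_ball] assms(1)]) (use assms in simp)

lemma DERIV_psi [derivative_intros]:
  assumes "(f has_field_derivative f') (at q)" "norm (f q) < 1"
  shows "((\<lambda>q. psi (f q)) has_field_derivative deriv psi (f q) * f') (at q)"
  by (rule DERIV_chain2[OF holomorphic_derivI[OF holomorphic_psi open_ball] assms(1)]) (use assms in simp)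

lemma eventually_norm_lt_1: "norm q < 1 \<Longrightarrow> eventually (\<lambda>z. norm (z :: complex) < 1) (nhds q)"
  using eventually_nhds_in_open[OF open_ball, of q "0 :: complex" 1] by simp

lemma DERIV_eq_on_ball:
  assumes "(f has_field_derivative a) (at q)" "(g has_field_derivative b) (at q)"
    and "\<And>z. norm (z :: complex) < 1 \<Longrightarrow> f z = g z" and q: "norm q < 1"
  shows "a = b"
proof -
  have "eventually (\<lambda>z. f z = g z) (nhds q)"
    using eventually_norm_lt_1[OF q] by eventually_elim (rule assms(3))
  then have "(g has_field_derivative a) (at q)"
    using assms(1) DERIV_cong_ev[of q q f g a a] by blast
  then show ?thesis using assms(2) by (rule DERIV_unique)
qed

lemma deriv_phi_0: "deriv phi 0 = 2"
proof -
  have "2 * phi 0 * deriv phi 0 + 2 * phi 0 * deriv phi 0 = 2 * (psi 0)\<^sup>2"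
  proof (rule DERIV_eq_on_ball[where q = 0])
    show "((\<lambda>q. (phi q)\<^sup>2 - (phi (- q))\<^sup>2) has_field_derivative 2 * phi 0 * deriv phi 0 + 2 * phi 0 * deriv phi 0) (at 0)"
      by (auto intro!: derivative_eq_intros)
    show "((\<lambda>q. 2 * q * (psi (q ^ 4))\<^sup>2) has_field_derivative 2 * (psi 0)\<^sup>2) (at 0)"
      by (auto intro!: derivative_eq_intros)
    show "(phi z)\<^sup>2 - (phi (- z))\<^sup>2 = 2 * z * (psi (z ^ 4))\<^sup>2" if "norm z < 1" for z
      using phi_squares[OF that] by simp
  qed simp
  then show ?thesis by (simp add: phi_0 psi_0)
qed

text \<open>
  Logarithmic derivatives of the two formulas of Landen's transformation,
  \<open>2 \<phi>(q\<^sup>2)\<^sup>2 = \<phi>(q)\<^sup>2 + \<phi>(-q)\<^sup>2\<close> and \<open>\<phi>(-q\<^sup>2)\<^sup>2 = \<phi>(q) \<phi>(-q)\<close>.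
\<close>

lemma logderiv_phi_landen:
  assumes q: "norm q < 1"
  shows "4 * q * (phi (q\<^sup>2))\<^sup>2 * logderiv_phi (q\<^sup>2) =
           (phi q)\<^sup>2 * logderiv_phi q - (phi (- q))\<^sup>2 * logderiv_phi (- q)"
    and "- 4 * q * logderiv_phi (- (q\<^sup>2)) = logderiv_phi q - logderiv_phi (- q)"
proof -
  have q2: "norm (q\<^sup>2) < 1" using norm_power_lt_1[OF q, of 2] by simp
  have nz: "phi q \<noteq> 0" "phi (- q) \<noteq> 0" "phi (q\<^sup>2) \<noteq> 0" "phi (- (q\<^sup>2)) \<noteq> 0"
    by (rule phi_nonzero; use q q2 in simp)+
  have D: "deriv phi z = phi z * logderiv_phi z" if "phi z \<noteq> 0" for z
    using that by (simp add: logderiv_phi_def)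
  have "2 * (2 * phi (q\<^sup>2) * (deriv phi (q\<^sup>2) * (2 * q))) = 2 * phi q * deriv phi q + 2 * phi (- q) * (deriv phi (- q) * - 1)"
  proof (rule DERIV_eq_on_ball[OF _ _ _ q])
    show "((\<lambda>q. 2 * (phi (q\<^sup>2))\<^sup>2) has_field_derivative 2 * (2 * phi (q\<^sup>2) * (deriv phi (q\<^sup>2) * (2 * q)))) (at q)"
      using q q2 by (auto intro!: derivative_eq_intros)
    show "((\<lambda>q. (phi q)\<^sup>2 + (phi (- q))\<^sup>2) has_field_derivative 2 * phi q * deriv phi q + 2 * phi (- q) * (deriv phi (- q) * - 1)) (at q)"
      using q q2 by (auto intro!: derivative_eq_intros)
    show "2 * (phi (z\<^sup>2))\<^sup>2 = (phi z)\<^sup>2 + (phi (- z))\<^sup>2" if "norm z < 1" for z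
      using phi_squares[OF that] by simp
  qed
  then show "4 * q * (phi (q\<^sup>2))\<^sup>2 * logderiv_phi (q\<^sup>2) =
           (phi q)\<^sup>2 * logderiv_phi q - (phi (- q))\<^sup>2 * logderiv_phi (- q)"
    unfolding D[OF nz(1)] D[OF nz(2)] D[OF nz(3)] by algebra
  have "2 * phi (- (q\<^sup>2)) * (deriv phi (- (q\<^sup>2)) * (- 2 * q)) =
      deriv phi q * phi (- q) + phi q * (deriv phi (- q) * - 1)"
  proof (rule DERIV_eq_on_ball[OF _ _ _ q])
    show "((\<lambda>q. (phi (- (q\<^sup>2)))\<^sup>2) has_field_derivative 2 * phi (- (q\<^sup>2)) * (deriv phi (- (q\<^sup>2)) * (- 2 * q))) (at q)"
      using q q2 by (auto intro!: derivative_eq_intros)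
    show "((\<lambda>q. phi q * phi (- q)) has_field_derivative deriv phi q * phi (- q) + phi q * (deriv phi (- q) * - 1)) (at q)"
      using q q2 by (auto intro!: derivative_eq_intros)
    show "(phi (- (z\<^sup>2)))\<^sup>2 = phi z * phi (- z)" if "norm z < 1" for z
      using phi_mult_phi_neg[OF that] by simp
  qed
  then have "(phi (- (q\<^sup>2)))\<^sup>2 * (- 4 * q * logderiv_phi (- (q\<^sup>2))) =
     phi q * phi (- q) * (logderiv_phi q - logderiv_phi (- q))"
    using nz by (simp add: D power2_eq_square algebra_simps)
  then show "- 4 * q * logderiv_phi (- (q\<^sup>2)) = logderiv_phi q - logderiv_phi (- q)"
    using nz unfolding phi_mult_phi_neg[OF q] by (subst (asm) mult_left_cancel) auto
qed

lemma holomorphic_logderiv_phi: "logderiv_phi holomorphic_on ball 0 1"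
  unfolding logderiv_phi_def
  by (intro holomorphic_on_divide holomorphic_deriv holomorphic_phi) (use phi_nonzero in auto)

lemma isCont_logderiv_phi: "isCont logderiv_phi q" if "norm q < 1"
  using holomorphic_on_imp_continuous_on[OF holomorphic_logderiv_phi] that
  by (auto simp: continuous_on_eq_continuous_at)

text \<open>
  Jacobi's formula for the logarithmic derivative of \<open>\<theta>\<^sub>3 / \<theta>\<^sub>4\<close>. By Landen's transformation the quotient
  of the two sides is invariant under \<open>q \<mapsto> q\<^sup>2\<close>, hence constant, and its value at \<open>0\<close> is \<open>1\<close>.
\<close>

theorem logderiv_phi_ratio:
  assumes q: "norm q < 1"
  shows "logderiv_phi q + logderiv_phi (- q) = psi (q\<^sup>2) ^ 4 / 4"
proof -
  define h where "h = (\<lambda>q. 4 * (logderiv_phi q + logderiv_phi (- q)) / psi (q\<^sup>2) ^ 4)"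
  have inv: "h (q\<^sup>2) = h q" if q: "norm q < 1" for q
  proof (cases "q = 0")
    case False
    have q2: "norm (q\<^sup>2) < 1" "norm (q ^ 4) < 1"
      using norm_power_lt_1[OF q, of 2] norm_power_lt_1[OF q, of 4] by simp_all
    have nz: "phi (q\<^sup>2) \<noteq> 0" "psi (q\<^sup>2) \<noteq> 0" "psi (q ^ 4) \<noteq> 0"
      using q2 by (auto simp: phi_nonzero psi_nonzero)
    let ?A = "logderiv_phi q" and ?B = "logderiv_phi (- q)"
    let ?M = "logderiv_phi (q\<^sup>2) + logderiv_phi (- (q\<^sup>2))"
    have "4 * q * (phi (q\<^sup>2))\<^sup>2 * ?M = (phi q)\<^sup>2 * ?A - (phi (- q))\<^sup>2 * ?B - (phi (q\<^sup>2))\<^sup>2 * (?A - ?B)"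
      using logderiv_phi_landen[OF q] by algebra
    also have "\<dots> = q * ((psi (q ^ 4))\<^sup>2 * (?A + ?B))"
      unfolding phi_squares[OF q] by (simp add: algebra_simps)
    finally have "q * (4 * (phi (q\<^sup>2))\<^sup>2 * ?M) = q * ((psi (q ^ 4))\<^sup>2 * (?A + ?B))"
      by (simp only: mult_ac)
    then have M: "4 * (phi (q\<^sup>2))\<^sup>2 * ?M = (psi (q ^ 4))\<^sup>2 * (?A + ?B)"
      using False by (subst (asm) mult_left_cancel) auto
    have p: "psi (q\<^sup>2) ^ 4 = 4 * (phi (q\<^sup>2))\<^sup>2 * (psi (q ^ 4))\<^sup>2"
    proof -
      have "psi (q\<^sup>2) ^ 4 = ((psi (q\<^sup>2))\<^sup>2)\<^sup>2" by simp
      also have "(psi (q\<^sup>2))\<^sup>2 = 2 * phi (q\<^sup>2) * psi (q ^ 4)"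
        using psi_square[OF q2(1)] by (simp add: power_mult[symmetric])
      finally show ?thesis by (simp add: power_mult_distrib)
    qed
    have "(q\<^sup>2)\<^sup>2 = q ^ 4" by simp
    then have "h (q\<^sup>2) = 4 * ?M / psi (q ^ 4) ^ 4" by (simp only: h_def)
    also have "?M = (psi (q ^ 4))\<^sup>2 * (?A + ?B) / (4 * (phi (q\<^sup>2))\<^sup>2)"
      using M nz by (simp add: field_simps)
    also have "4 * \<dots> / psi (q ^ 4) ^ 4 = 4 * (?A + ?B) / (4 * (phi (q\<^sup>2))\<^sup>2 * (psi (q ^ 4))\<^sup>2)"
      using nz by (simp add: divide_simps) (simp add: power2_eq_square power4_eq_xxxx)
    finally show ?thesis by (simp only: h_def p)
  qed simp
  have cont: "isCont h 0"
    unfolding h_def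
  proof (intro isCont_divide isCont_mult isCont_add isCont_power continuous_const)
    show "isCont (\<lambda>q. logderiv_phi (- q)) 0"
      by (rule isCont_o2[where g = logderiv_phi]) (auto intro: isCont_logderiv_phi)
    show "isCont (\<lambda>q. psi (q\<^sup>2)) 0"
      by (rule isCont_o2[where g = psi]) (auto intro: isCont_psi)
  qed (auto simp: psi_0 intro: isCont_logderiv_phi)
  have "h 0 = 1" by (simp add: h_def psi_0 logderiv_phi_def phi_0 deriv_phi_0)
  with squaring_invariant_imp_constant[OF inv cont q] have "h q = 1" by simp
  moreover have "norm (q\<^sup>2) < 1" using norm_power_lt_1[OF q, of 2] by simp
  ultimately show ?thesis using psi_nonzero[of "q\<^sup>2"] by (simp add: h_def field_simps)
qed


text \<open>
  The logarithmic derivative of \<open>phi\<^sup>2\<close> with respect to \<open>q d/dq\<close>.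
\<close>

definition log_deriv_phi_square :: "complex \<Rightarrow> complex" where
  "log_deriv_phi_square q = 2 * q * logderiv_phi q"

text \<open>
  The first formula of Landen's transformation after \<open>logderiv_phi (- q)\<close> has been eliminated by Jacobi's
  formula.
\<close>

lemma log_deriv_phi_square_landen:
  assumes q: "norm q < 1"
  shows "2 * log_deriv_phi_square (q\<^sup>2) = log_deriv_phi_square q - (phi (- q))\<^sup>2 * ((phi q)\<^sup>2 - (phi (- q))\<^sup>2) / 2"
proof -
  have q2: "norm (q\<^sup>2) < 1" using norm_power_lt_1[OF q, of 2] by simp
  define u v U A L W where defs: "u = (phi q)\<^sup>2" "v = (phi (- q))\<^sup>2" "U = (phi (q\<^sup>2))\<^sup>2"
    "A = logderiv_phi q" "L = logderiv_phi (q\<^sup>2)" "W = psi (q\<^sup>2) ^ 4"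
  have U: "U \<noteq> 0" using phi_nonzero[OF q2] by (simp add: defs)
  have "u = U + q * (psi (q ^ 4))\<^sup>2" "v = U - q * (psi (q ^ 4))\<^sup>2"
    using phi_squares[OF q] by (simp_all add: defs)
  then have uv: "u + v = 2 * U" by simp
  have "phi q ^ 4 = u\<^sup>2" "phi (- q) ^ 4 = v\<^sup>2" by (simp_all add: defs)
  then have W: "q * W = u\<^sup>2 - v\<^sup>2" using phi_quartic[OF q] by (simp add: defs)
  have B: "logderiv_phi (- q) = W / 4 - A"
    using logderiv_phi_ratio[OF q] by (simp add: defs algebra_simps)
  have "4 * q * U * L = u * A - v * (W / 4 - A)"
    using logderiv_phi_landen(1)[OF q] by (simp only: defs[symmetric] B)
  also have "\<dots> = (u + v) * A - v * W / 4" by (simp add: field_simps)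
  finally have "4 * q * U * L = 2 * U * A - v * W / 4" by (simp only: uv)
  then have "4 * q\<^sup>2 * U * L = q * (2 * U * A - v * W / 4)"
    by (metis (no_types, lifting) mult.assoc mult.commute power2_eq_square)
  also have "\<dots> = 2 * q * A * U - v * (q * W) / 4"
    by (simp add: field_simps)
  also have "q * W = (u - v) * (2 * U)" unfolding W uv[symmetric] by (simp add: power2_eq_square algebra_simps)
  also have "2 * q * A * U - v * ((u - v) * (2 * U)) / 4 = U * (2 * q * A - v * (u - v) / 2)"
    by (simp add: field_simps)
  finally have "U * (4 * q\<^sup>2 * L) = U * (2 * q * A - v * (u - v) / 2)"
    by (simp only: mult_ac)
  then have "4 * q\<^sup>2 * L = 2 * q * A - v * (u - v) / 2"
    using U by (subst (asm) mult_left_cancel)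
  then show ?thesis by (simp add: log_deriv_phi_square_def defs mult.assoc)
qed

lemma holomorphic_log_deriv_phi_square: "log_deriv_phi_square holomorphic_on ball 0 1"
  unfolding log_deriv_phi_square_def by (intro holomorphic_intros holomorphic_logderiv_phi)

lemma DERIV_log_deriv_phi_square [derivative_intros]:
  assumes "(f has_field_derivative f') (at q)" "norm (f q) < 1"
  shows "((\<lambda>q. log_deriv_phi_square (f q)) has_field_derivative deriv log_deriv_phi_square (f q) * f') (at q)"
  by (rule DERIV_chain2[OF holomorphic_derivI[OF holomorphic_log_deriv_phi_square open_ball] assms(1)]) (use assms in simp)

lemma phi_neg_logderiv:
  assumes q: "norm q < 1"
  shows "2 * q * logderiv_phi (- q) = (phi q ^ 4 - phi (- q) ^ 4) / 2 - log_deriv_phi_square q"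
proof -
  have "logderiv_phi (- q) = psi (q\<^sup>2) ^ 4 / 4 - logderiv_phi q"
    using logderiv_phi_ratio[OF q] by (simp add: algebra_simps)
  then show ?thesis unfolding phi_quartic[OF q] log_deriv_phi_square_def by (simp only:) (simp add: field_simps)
qed

text \<open>
  This first-order equation for the logarithmic derivative is the hypergeometric equation of the complete
  elliptic integral in disguise. The difference of the two sides is multiplied by \<open>1/4\<close> under \<open>q \<mapsto> q\<^sup>2\<close>,
  by Landen's transformation and the first-order formula above. It vanishes at \<open>0\<close>, and dividing it by \<open>q\<close>
  brings it into the form in which squaring forces it to vanish identically.
\<close>

theorem theta_riccati:
  assumes q: "norm q < 1"
  shows "q * deriv log_deriv_phi_square q = (log_deriv_phi_square q)\<^sup>2 + phi (- q) ^ 4 * (phi q ^ 4 - phi (- q) ^ 4) / 4"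
proof -
  define E where "E = (\<lambda>q. deriv log_deriv_phi_square q - 4 * q * (logderiv_phi q)\<^sup>2 - phi (- q) ^ 4 * psi (q\<^sup>2) ^ 4 / 4)"
  have qE: "q * E q = q * deriv log_deriv_phi_square q - (log_deriv_phi_square q)\<^sup>2 - phi (- q) ^ 4 * (phi q ^ 4 - phi (- q) ^ 4) / 4"
    if "norm q < 1" for q
    unfolding phi_quartic[OF that] E_def log_deriv_phi_square_def by (simp add: power2_eq_square algebra_simps)
  have "E q = 4 * q * E (q\<^sup>2)" if q: "norm q < 1" and q0: "q \<noteq> 0" for q
  proof -
    have q2: "norm (q\<^sup>2) < 1" using norm_power_lt_1[OF q, of 2] by simp
    define u v l d V U where defs: "u = (phi q)\<^sup>2" "v = (phi (- q))\<^sup>2" "l = log_deriv_phi_square q" "d = deriv log_deriv_phi_square q"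
      "V = (phi (- (q\<^sup>2)))\<^sup>2" "U = (phi (q\<^sup>2))\<^sup>2"
    define du dv where ddefs: "du = 2 * phi q * deriv phi q" "dv = 2 * phi (- q) * (deriv phi (- q) * - 1)"
    have p4: "phi q ^ 4 = u\<^sup>2" "phi (- q) ^ 4 = v\<^sup>2" "phi (q\<^sup>2) ^ 4 = U\<^sup>2" "phi (- (q\<^sup>2)) ^ 4 = V\<^sup>2"
      by (simp_all add: defs)
    have V: "V = phi q * phi (- q)" using phi_mult_phi_neg[OF q] by (simp add: defs)
    then have V2: "V\<^sup>2 = u * v" by (simp add: defs power_mult_distrib)
    have U: "U = (u + v) / 2" using phi_squares[OF q] by (simp add: defs)
    have F: "log_deriv_phi_square (q\<^sup>2) = l / 2 - v * (u - v) / 4"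
      using log_deriv_phi_square_landen[OF q] by (simp add: defs field_simps)
    have qdu: "q * du = u * l"
      using phi_nonzero[OF q] by (simp add: ddefs defs log_deriv_phi_square_def logderiv_phi_def power2_eq_square)
    have "q * dv = - (v * (2 * q * logderiv_phi (- q)))"
      using phi_nonzero[of "- q"] q by (simp add: ddefs defs logderiv_phi_def power2_eq_square)
    then have qdv: "q * dv = v * (l - (u\<^sup>2 - v\<^sup>2) / 2)"
      unfolding phi_neg_logderiv[OF q] p4 defs(3)[symmetric] by (simp add: algebra_simps)
    have "2 * (deriv log_deriv_phi_square (q\<^sup>2) * (2 * q)) = d - (dv * (u - v) + v * (du - dv)) / 2"
    proof (rule DERIV_eq_on_ball[OF _ _ _ q])
      show "((\<lambda>q. 2 * log_deriv_phi_square (q\<^sup>2)) has_field_derivative 2 * (deriv log_deriv_phi_square (q\<^sup>2) * (2 * q))) (at q)"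
        using q q2 by (auto intro!: derivative_eq_intros)
      have D: "((\<lambda>q. (phi q)\<^sup>2) has_field_derivative du) (at q)" "((\<lambda>q. (phi (- q))\<^sup>2) has_field_derivative dv) (at q)"
        using q by (auto intro!: derivative_eq_intros simp: ddefs)
      have "((\<lambda>q. log_deriv_phi_square q) has_field_derivative d) (at q)"
        using q by (auto intro!: derivative_eq_intros simp: defs)
      then show "((\<lambda>q. log_deriv_phi_square q - (phi (- q))\<^sup>2 * ((phi q)\<^sup>2 - (phi (- q))\<^sup>2) / 2) has_field_derivative
         d - (dv * (u - v) + v * (du - dv)) / 2) (at q)"
        using DERIV_diff[OF _ DERIV_cdivide[OF DERIV_mult'[OF D(2) DERIV_diff[OF D]], of 2]]
        by (simp add: defs(1,2) add.commute)
      show "2 * log_deriv_phi_square (z\<^sup>2) = log_deriv_phi_square z - (phi (- z))\<^sup>2 * ((phi z)\<^sup>2 - (phi (- z))\<^sup>2) / 2" if "norm z < 1" for z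
        by (rule log_deriv_phi_square_landen[OF that])
    qed
    then have "q * (2 * (deriv log_deriv_phi_square (q\<^sup>2) * (2 * q))) = q * (d - (dv * (u - v) + v * (du - dv)) / 2)"
      by (simp only:)
    also have "\<dots> = q * d - (q * dv * (u - v) + v * (q * du - q * dv)) / 2"
      by (simp add: field_simps)
    finally have "q * (2 * (deriv log_deriv_phi_square (q\<^sup>2) * (2 * q))) = q * d - (q * dv * (u - v) + v * (q * du - q * dv)) / 2" .
    then have d2: "4 * (q\<^sup>2 * deriv log_deriv_phi_square (q\<^sup>2)) = q * d -
       (v * (l - (u\<^sup>2 - v\<^sup>2) / 2) * (u - v) + v * (u * l - v * (l - (u\<^sup>2 - v\<^sup>2) / 2))) / 2"
      unfolding qdu qdv by (simp add: power2_eq_square mult_ac)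
    have "4 * (q\<^sup>2 * E (q\<^sup>2)) = 4 * (q\<^sup>2 * deriv log_deriv_phi_square (q\<^sup>2)) - 4 * (l / 2 - v * (u - v) / 4)\<^sup>2
        - u * v * (((u + v) / 2)\<^sup>2 - u * v)"
      unfolding qE[OF q2] p4 F V2 U by (simp add: field_simps)
    also have "\<dots> = q * d - l\<^sup>2 - v\<^sup>2 * (u\<^sup>2 - v\<^sup>2) / 4"
      unfolding d2 by (simp add: field_simps power2_eq_square)
    also have "\<dots> = q * E q"
      unfolding qE[OF q] p4 by (simp add: defs)
    finally have "4 * (q\<^sup>2 * E (q\<^sup>2)) = q * E q" .
    moreover have "4 * (q\<^sup>2 * E (q\<^sup>2)) = q * (4 * q * E (q\<^sup>2))" by (simp only: power2_eq_square mult_ac)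
    ultimately have "q * E q = q * (4 * q * E (q\<^sup>2))" by (simp only:)
    then show ?thesis using q0 by (subst (asm) mult_left_cancel)
  qed
  moreover have "continuous_on (ball 0 1) E"
    unfolding E_def
    by (intro holomorphic_on_imp_continuous_on holomorphic_intros holomorphic_deriv holomorphic_log_deriv_phi_square open_ball
        holomorphic_logderiv_phi holomorphic_on_compose_gen[OF _ holomorphic_phi, unfolded o_def]
        holomorphic_on_compose_gen[OF _ holomorphic_psi, unfolded o_def])
       (auto simp: norm_power power_less_one_iff)
  ultimately have "q \<noteq> 0 \<Longrightarrow> E q = 0"
    using squaring_contraction_imp_zero[of E q] q by blast
  then have "q * E q = 0" by auto
  then show ?thesis unfolding qE[OF q] by (simp add: algebra_simps)
qed

section \<open>The modular equation of degree 3 and its rational parametrisation\<close>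

text \<open>
  The modular function \<open>\<lambda> = \<theta>\<^sub>2\<^sup>4 / \<theta>\<^sub>3\<^sup>4\<close> of the nome, in the form \<open>1 - \<theta>\<^sub>4\<^sup>4 / \<theta>\<^sub>3\<^sup>4\<close>.
\<close>

definition modular_lambda :: "complex \<Rightarrow> complex" where
  "modular_lambda q = 1 - (phi (- q) / phi q) ^ 4"

text \<open>
  This is \<open>\<theta>\<^sub>2(q) \<theta>\<^sub>2(q\<^sup>3) / (\<theta>\<^sub>3(q) \<theta>\<^sub>3(q\<^sup>3))\<close>.
\<close>

definition cubic_f :: "complex \<Rightarrow> complex" where
  "cubic_f q = q * psi (q\<^sup>2) * psi (q ^ 6) / (phi q * phi (q ^ 3))"

text \<open>
  With \<open>f = cubic_f q\<close>, this is \<open>(\<lambda>(q) - \<lambda>(q\<^sup>3)) / (4 f (1 - f))\<close> after cancelling a factor \<open>q\<close>, which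
  extends it to \<open>q = 0\<close>.
\<close>

definition cubic_w :: "complex \<Rightarrow> complex" where
  "cubic_w q = (psi (q\<^sup>2) ^ 4 / phi q ^ 4 - q\<^sup>2 * psi (q ^ 6) ^ 4 / phi (q ^ 3) ^ 4) /
     (4 * (psi (q\<^sup>2) * psi (q ^ 6) / (phi q * phi (q ^ 3))) *
       (phi (- q) * phi (- (q ^ 3)) / (phi q * phi (q ^ 3))))"

text \<open>
  The relation \<open>w\<^sup>2 = 1 - f + f\<^sup>2\<close> describes a conic; this is the rational parameter on it that turns out to be
  the eta quotient.
\<close>

definition hauptmodul :: "complex \<Rightarrow> complex" where
  "hauptmodul q = (2 + cubic_w q - cubic_f q) / (1 + 2 * cubic_w q - 2 * cubic_f q)"

lemma cubic_nonzero:
  assumes q: "norm q < 1"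
  shows "phi q \<noteq> 0" "phi (- q) \<noteq> 0" "phi (q ^ 3) \<noteq> 0" "phi (- (q ^ 3)) \<noteq> 0" "psi (q\<^sup>2) \<noteq> 0" "psi (q ^ 6) \<noteq> 0"
  using q norm_power_lt_1[OF q, of 2] norm_power_lt_1[OF q, of 3] norm_power_lt_1[OF q, of 6]
  by (auto intro!: phi_nonzero psi_nonzero)

lemma modular_lambda_alt: "modular_lambda q = q * psi (q\<^sup>2) ^ 4 / phi q ^ 4" if "norm q < 1"
  unfolding phi_quartic[OF that, symmetric] modular_lambda_def
  using phi_nonzero[OF that] by (simp add: power_divide diff_divide_distrib)

lemma modular_lambda_cube_alt: "modular_lambda (q ^ 3) = q ^ 3 * psi (q ^ 6) ^ 4 / phi (q ^ 3) ^ 4" if "norm q < 1"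
  using modular_lambda_alt[OF norm_power_lt_1[OF that, of 3]] by (simp add: power_mult[symmetric])

lemma one_minus_cubic_f:
  assumes q: "norm q < 1"
  shows "1 - cubic_f q = phi (- q) * phi (- (q ^ 3)) / (phi q * phi (q ^ 3))"
proof -
  have "cubic_f q = (phi q * phi (q ^ 3) - phi (- q) * phi (- (q ^ 3))) / (phi q * phi (q ^ 3))"
    unfolding cubic_theta_identity[OF q] cubic_f_def ..
  then show ?thesis using cubic_nonzero[OF q] by (simp add: diff_divide_distrib)
qed

lemma one_minus_cubic_f_nonzero: "1 - cubic_f q \<noteq> 0" if "norm q < 1"
  unfolding one_minus_cubic_f[OF that] using cubic_nonzero[OF that] by simp

lemma modular_lambda_product: "modular_lambda q * modular_lambda (q ^ 3) = cubic_f q ^ 4" if "norm q < 1"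
  unfolding modular_lambda_alt[OF that] modular_lambda_cube_alt[OF that] cubic_f_def
  by (simp add: power_divide power_mult_distrib flip: power_Suc)

lemma one_minus_modular_lambda_product: "(1 - modular_lambda q) * (1 - modular_lambda (q ^ 3)) = (1 - cubic_f q) ^ 4" if "norm q < 1"
  unfolding one_minus_cubic_f[OF that] modular_lambda_def by (simp add: power_divide power_mult_distrib)

text \<open>
  The modular equation \<open>f + (1 - f) = 1\<close> gives the product \<open>f\<^sup>4\<close> of \<open>\<lambda>(q)\<close> and \<open>\<lambda>(q\<^sup>3)\<close> and the product
  of their complements. Their sum is therefore a polynomial in \<open>f\<close>, and they are the roots of a quadratic
  equation over the field of rational functions of \<open>f\<close>, with discriminant \<open>16 f\<^sup>2 (1 - f)\<^sup>2 (1 - f + f\<^sup>2)\<close>.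
\<close>

lemma modular_lambda_sum:
  assumes q: "norm q < 1"
  shows "modular_lambda q + modular_lambda (q ^ 3) = 4 * cubic_f q - 6 * cubic_f q ^ 2 + 4 * cubic_f q ^ 3"
  using modular_lambda_product[OF q] one_minus_modular_lambda_product[OF q]
  by (simp add: power2_eq_square power3_eq_cube power4_eq_xxxx algebra_simps)

lemma modular_lambda_difference:
  assumes q: "norm q < 1"
  shows "modular_lambda q - modular_lambda (q ^ 3) = 4 * cubic_f q * (1 - cubic_f q) * cubic_w q"
proof -
  define P R where "P = psi (q\<^sup>2) * psi (q ^ 6) / (phi q * phi (q ^ 3))"
    and "R = psi (q\<^sup>2) ^ 4 / phi q ^ 4 - q\<^sup>2 * psi (q ^ 6) ^ 4 / phi (q ^ 3) ^ 4"
  have P: "P \<noteq> 0" using cubic_nonzero[OF q] by (simp add: P_def)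
  have w: "cubic_w q = R / (4 * P * (1 - cubic_f q))"
    unfolding one_minus_cubic_f[OF q] cubic_w_def P_def R_def ..
  have f: "cubic_f q = q * P" by (simp add: cubic_f_def P_def)
  have "modular_lambda q - modular_lambda (q ^ 3) = q * R"
    unfolding modular_lambda_alt[OF q] modular_lambda_cube_alt[OF q] R_def
    by (simp add: power2_eq_square power3_eq_cube algebra_simps)
  also have "\<dots> = 4 * (q * P) * (1 - cubic_f q) * (R / (4 * P * (1 - cubic_f q)))"
    using P one_minus_cubic_f_nonzero[OF q] by simp
  finally show ?thesis unfolding w f .
qed

lemma cubic_f_eq_0_iff: "cubic_f q = 0 \<longleftrightarrow> q = 0" if "norm q < 1"
  using cubic_nonzero[OF that] by (simp add: cubic_f_def)

lemma cubic_w_square: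
  assumes q: "norm q < 1"
  shows "cubic_w q ^ 2 = 1 - cubic_f q + cubic_f q ^ 2"
proof (cases "q = 0")
  case True
  then show ?thesis by (simp add: cubic_w_def cubic_f_def phi_0 psi_0)
next
  case False
  define f w a b where defs: "f = cubic_f q" "w = cubic_w q" "a = modular_lambda q" "b = modular_lambda (q ^ 3)"
  have nz: "16 * f\<^sup>2 * (1 - f)\<^sup>2 \<noteq> 0"
    using False cubic_f_eq_0_iff[OF q] one_minus_cubic_f_nonzero[OF q] by (simp add: defs)
  have "16 * f\<^sup>2 * (1 - f)\<^sup>2 * w\<^sup>2 = (a - b)\<^sup>2"
    unfolding defs modular_lambda_difference[OF q] by (simp add: power_mult_distrib)
  also have "\<dots> = (a + b)\<^sup>2 - 4 * (a * b)" by (simp add: power2_eq_square algebra_simps)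
  also have "\<dots> = (4 * f - 6 * f\<^sup>2 + 4 * f ^ 3)\<^sup>2 - 4 * f ^ 4"
    unfolding defs modular_lambda_sum[OF q] modular_lambda_product[OF q] ..
  also have "\<dots> = 16 * f\<^sup>2 * (1 - f)\<^sup>2 * (1 - f + f\<^sup>2)" by algebra
  finally show ?thesis using nz unfolding defs[symmetric] by (subst (asm) mult_left_cancel)
qed

lemma hauptmodul_denominator: "1 + 2 * cubic_w q - 2 * cubic_f q \<noteq> 0" if q: "norm q < 1"
proof
  assume "1 + 2 * cubic_w q - 2 * cubic_f q = 0"
  then have "cubic_w q = cubic_f q - 1 / 2" by (simp add: field_simps)
  with cubic_w_square[OF q] have "(cubic_f q - 1 / 2)\<^sup>2 = 1 - cubic_f q + (cubic_f q)\<^sup>2" by simp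
  then show False by (simp add: power2_eq_square field_simps)
qed

lemma hauptmodul_param:
  assumes q: "norm q < 1"
  defines "X \<equiv> hauptmodul q"
  shows "2 * X - 1 \<noteq> 0" "cubic_f q = (X\<^sup>2 - 1) / (2 * X - 1)" "1 - cubic_f q = X * (2 - X) / (2 * X - 1)"
    "cubic_w q = (X\<^sup>2 - X + 1) / (2 * X - 1)"
proof -
  define f w D where defs: "f = cubic_f q" "w = cubic_w q" "D = 1 + 2 * w - 2 * f"
  have D: "D \<noteq> 0" using hauptmodul_denominator[OF q] by (simp add: defs)
  have w2: "w\<^sup>2 = 1 - f + f\<^sup>2" using cubic_w_square[OF q] by (simp add: defs)
  have X: "X = (2 + w - f) / D" by (simp add: X_def hauptmodul_def defs)
  have e: "2 * X - 1 = 3 / D" using D by (simp add: X field_simps) (simp add: defs)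
  then show nz: "2 * X - 1 \<noteq> 0" using D by simp
  have "X\<^sup>2 - 1 = ((2 + w - f)\<^sup>2 - D\<^sup>2) / D\<^sup>2"
    using D by (simp add: X power_divide field_simps)
  also have "(2 + w - f)\<^sup>2 - D\<^sup>2 = 3 * (f * D)"
    using w2 unfolding defs(3) by algebra
  finally have "X\<^sup>2 - 1 = f * (2 * X - 1)"
    unfolding e using D by (simp add: power2_eq_square)
  then show f: "cubic_f q = (X\<^sup>2 - 1) / (2 * X - 1)" using nz by (simp add: defs)
  show "1 - cubic_f q = X * (2 - X) / (2 * X - 1)"
    unfolding f using nz by (simp add: field_simps power2_eq_square)
  have "X * D = 2 + w - f" using D by (simp add: X)
  then have "w * (2 * X - 1) = 2 - X + f * (2 * X - 1)" by (simp add: defs algebra_simps)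
  then have "w * (2 * X - 1) = X\<^sup>2 - X + 1"
    using \<open>X\<^sup>2 - 1 = f * (2 * X - 1)\<close> by algebra
  then show "cubic_w q = (X\<^sup>2 - X + 1) / (2 * X - 1)" using nz by (simp add: defs field_simps)
qed

text \<open>
  The degree 4 covering \<open>x \<mapsto> \<lambda>\<close>. It is ramified only above \<open>0\<close>, \<open>1\<close> and \<open>\<infinity>\<close>, which is why the differential
  equation for \<open>x\<close> has singularities only at the six points above these.
\<close>

theorem modular_lambda_hauptmodul:
  assumes q: "norm q < 1"
  defines "X \<equiv> hauptmodul q"
  shows "modular_lambda q = (X - 1) * (X + 1) ^ 3 / (2 * X - 1) ^ 3"
    and "1 - modular_lambda q = X * (2 - X) ^ 3 / (2 * X - 1) ^ 3"
    and "1 - modular_lambda (q ^ 3) = X ^ 3 * (2 - X) / (2 * X - 1)"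
proof -
  define D where "D = 2 * X - 1"
  note P = hauptmodul_param[OF q, folded X_def, folded D_def]
  define f w where fw: "f = cubic_f q" "w = cubic_w q"
  have fD: "f * D = X\<^sup>2 - 1" and wD: "w * D = X\<^sup>2 - X + 1"
    using P by (simp_all add: fw)
  have s: "modular_lambda q + modular_lambda (q ^ 3) = 4 * f - 6 * f\<^sup>2 + 4 * f ^ 3"
    and d: "modular_lambda q - modular_lambda (q ^ 3) = 4 * f * (1 - f) * w"
    unfolding fw by (rule modular_lambda_sum[OF q], rule modular_lambda_difference[OF q])
  have l1: "modular_lambda q = 2 * f - 3 * f\<^sup>2 + 2 * f ^ 3 + 2 * f * (1 - f) * w"
  proof -
    have "2 * modular_lambda q = (modular_lambda q + modular_lambda (q ^ 3)) + (modular_lambda q - modular_lambda (q ^ 3))" by simp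
    then show ?thesis unfolding s d by algebra
  qed
  have l3: "modular_lambda (q ^ 3) = 2 * f - 3 * f\<^sup>2 + 2 * f ^ 3 - 2 * f * (1 - f) * w"
  proof -
    have "2 * modular_lambda (q ^ 3) = (modular_lambda q + modular_lambda (q ^ 3)) - (modular_lambda q - modular_lambda (q ^ 3))" by simp
    then show ?thesis unfolding s d by algebra
  qed
  have "modular_lambda q * D ^ 3 = 2 * (f * D) * D\<^sup>2 - 3 * (f * D)\<^sup>2 * D + 2 * (f * D) ^ 3 + 2 * (f * D) * (D - f * D) * (w * D)"
    unfolding l1 by algebra
  also have "\<dots> = (X - 1) * (X + 1) ^ 3"
    unfolding fD wD unfolding D_def by algebra
  finally show 1: "modular_lambda q = (X - 1) * (X + 1) ^ 3 / (2 * X - 1) ^ 3"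
    using P(1) unfolding D_def[symmetric] by (simp add: eq_divide_eq)
  have "modular_lambda (q ^ 3) * D ^ 3 = 2 * (f * D) * D\<^sup>2 - 3 * (f * D)\<^sup>2 * D + 2 * (f * D) ^ 3 - 2 * (f * D) * (D - f * D) * (w * D)"
    unfolding l3 by algebra
  also have "\<dots> = (X - 1) ^ 3 * (X + 1) * D\<^sup>2"
    unfolding fD wD unfolding D_def by algebra
  finally have "modular_lambda (q ^ 3) * D * D\<^sup>2 = (X - 1) ^ 3 * (X + 1) * D\<^sup>2" 
    by (simp add: power2_eq_square power3_eq_cube mult_ac)
  then have 3: "modular_lambda (q ^ 3) * D = (X - 1) ^ 3 * (X + 1)" using P(1) by simp
  have "1 - modular_lambda q = ((2 * X - 1) ^ 3 - (X - 1) * (X + 1) ^ 3) / (2 * X - 1) ^ 3"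
    unfolding 1 using P(1) unfolding D_def by (simp add: diff_divide_distrib)
  also have "(2 * X - 1) ^ 3 - (X - 1) * (X + 1) ^ 3 = X * (2 - X) ^ 3" by algebra
  finally show "1 - modular_lambda q = X * (2 - X) ^ 3 / (2 * X - 1) ^ 3" .
  have "(1 - modular_lambda (q ^ 3)) * D = X ^ 3 * (2 - X)"
    using 3 unfolding D_def by algebra
  then show "1 - modular_lambda (q ^ 3) = X ^ 3 * (2 - X) / (2 * X - 1)"
    using P(1) unfolding D_def[symmetric] by (simp add: eq_divide_eq)
qed

lemma hauptmodul_avoids:
  assumes q: "norm q < 1"
  defines "X \<equiv> hauptmodul q"
  shows "X \<noteq> 0" "X \<noteq> 2" "2 * X \<noteq> 1" and "q \<noteq> 0 \<Longrightarrow> X \<noteq> 1" "q \<noteq> 0 \<Longrightarrow> X \<noteq> -1"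
  using hauptmodul_param[OF q] one_minus_cubic_f_nonzero[OF q] cubic_f_eq_0_iff[OF q]
  by (auto simp: X_def)

section \<open>The eta quotient as rational parameter\<close>

lemma isCont_euler:
  assumes z: "norm z < 1"
  shows "isCont euler z"
proof -
  obtain r where r: "norm z < r" "r < 1" using dense[OF z] by blast
  have r0: "r \<ge> 0" using r norm_ge_zero[of z] by linarith
  have "uniformly_convergent_on (cball 0 r) (\<lambda>N x :: complex. \<Prod>n<N. 1 - x ^ Suc n)"
  proof (rule uniformly_convergent_on_prod')
    show "uniformly_convergent_on (cball 0 r) (\<lambda>N x :: complex. \<Sum>n<N. norm (1 - x ^ Suc n - 1))"
    proof (rule Weierstrass_m_test')
      show "summable (\<lambda>n. r ^ Suc n)"
        using r r0 by (simp add: summable_geometric summable_mult)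
      show "norm (norm (1 - x ^ Suc n - 1)) \<le> r ^ Suc n" if "x \<in> cball 0 r" for n and x :: complex
        using that power_mono[of "norm x" r "Suc n"] by (simp add: norm_power norm_mult)
    qed
  qed (auto intro!: continuous_intros)
  then have "uniform_limit (cball 0 r) (\<lambda>N x :: complex. \<Prod>n<N. 1 - x ^ Suc n)
      (\<lambda>x. lim (\<lambda>N. \<Prod>n<N. 1 - x ^ Suc n)) sequentially"
    by (simp only: uniformly_convergent_uniform_limit_iff)
  then have "continuous_on (cball 0 r) (\<lambda>x :: complex. lim (\<lambda>N. \<Prod>n<N. 1 - x ^ Suc n))"
    by (rule uniform_limit_theorem[rotated]) (auto intro!: always_eventually continuous_intros)
  also have "?this \<longleftrightarrow> continuous_on (cball 0 r) euler"
  proof (rule continuous_on_cong)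
    fix x :: complex assume "x \<in> cball 0 r"
    then have "q_pochhammer x \<longlonglongrightarrow> euler x" using r by (intro q_pochhammer_tendsto) simp
    then show "lim (\<lambda>N. \<Prod>n<N. 1 - x ^ Suc n) = euler x"
      unfolding q_pochhammer_def[abs_def] by (rule limI)
  qed simp
  finally have "continuous_on (ball 0 r) euler"
    by (rule continuous_on_subset) auto
  then show ?thesis using r by (simp add: continuous_on_eq_continuous_at)
qed

lemma euler_0: "euler 0 = 1"
  by (simp add: euler_def)

definition eta_quotient :: "complex \<Rightarrow> complex" where
  "eta_quotient q = (euler (q\<^sup>2) ^ 3 * euler (q ^ 3) ^ 6 * euler (q ^ 12) ^ 3) /
     (euler q ^ 2 * euler (q ^ 4) * euler (q ^ 6) ^ 9)"

lemma one_minus_modular_lambda_eq_euler: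
  assumes q: "norm q < 1"
  shows "1 - modular_lambda q = (euler q ^ 4 * euler (q ^ 4) ^ 2 / euler (q\<^sup>2) ^ 6) ^ 4"
proof -
  have q2: "norm (q\<^sup>2) < 1" "norm (q ^ 4) < 1"
    using norm_power_lt_1[OF q, of 2] norm_power_lt_1[OF q, of 4] by simp_all
  define e1 e2 e4 where e: "e1 = euler q" "e2 = euler (q\<^sup>2)" "e4 = euler (q ^ 4)"
  have nz: "e1 \<noteq> 0" "e2 \<noteq> 0" "e4 \<noteq> 0" using q q2 by (simp_all add: e euler_nonzero)
  have m: "phi (- q) = e1\<^sup>2 / e2"
    using gauss_theta_product[OF q] nz by (simp add: e field_simps)
  have "phi (- (q\<^sup>2)) * e4 = e2\<^sup>2"
    using gauss_theta_product[OF q2(1)] by (simp add: e power_mult[symmetric])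
  then have m2: "phi (- (q\<^sup>2)) = e2\<^sup>2 / e4" using nz by (simp add: field_simps)
  have "phi (- q) / phi q = (phi (- q))\<^sup>2 / (phi q * phi (- q))"
    using cubic_nonzero[OF q] by (simp add: power2_eq_square)
  also have "phi q * phi (- q) = (e2\<^sup>2 / e4)\<^sup>2"
    unfolding phi_mult_phi_neg[OF q] m2 ..
  also have "(phi (- q))\<^sup>2 / (e2\<^sup>2 / e4)\<^sup>2 = (e1\<^sup>2 / e2)\<^sup>2 / (e2\<^sup>2 / e4)\<^sup>2"
    unfolding m ..
  also have "\<dots> = e1 ^ 4 * e4 ^ 2 / e2 ^ 6"
    using nz by (simp add: power_divide divide_simps)
  finally show ?thesis by (simp add: modular_lambda_def e)
qed

lemma holomorphic_hauptmodul: "hauptmodul holomorphic_on ball 0 1"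
proof -
  have [simp]: "norm z < 1 \<Longrightarrow> norm (z ^ k) < 1" if "k > 0" for k and z :: complex
    using norm_power_lt_1 that by blast
  have P: "(\<lambda>q. phi (h q)) holomorphic_on ball 0 1" "(\<lambda>q. psi (h q)) holomorphic_on ball 0 1"
    if "h holomorphic_on ball 0 1" "\<And>z. norm z < 1 \<Longrightarrow> norm (h z) < 1" for h
  proof -
    have "h ` ball 0 1 \<subseteq> ball 0 1" using that by auto
    then show "(\<lambda>q. phi (h q)) holomorphic_on ball 0 1" "(\<lambda>q. psi (h q)) holomorphic_on ball 0 1"
      using holomorphic_on_compose_gen[OF that(1) holomorphic_phi] holomorphic_on_compose_gen[OF that(1) holomorphic_psi]
      by (simp_all add: o_def)
  qed
  have "cubic_f holomorphic_on ball 0 1" "cubic_w holomorphic_on ball 0 1"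
    unfolding cubic_f_def[abs_def] cubic_w_def[abs_def]
    by (intro holomorphic_intros P; use cubic_nonzero in simp)+
  then show ?thesis
    unfolding hauptmodul_def[abs_def] using hauptmodul_denominator by (intro holomorphic_intros) auto
qed

text \<open>
  Gauss's product expresses both \<open>1 - \<lambda>(q)\<close> and \<open>1 - \<lambda>(q\<^sup>3)\<close> by the Euler product, and the eighth power
  of the eta quotient is \<open>(1 - \<lambda>(q\<^sup>3))\<^sup>3 / (1 - \<lambda>(q))\<close>. In terms of the rational parameter this is
  the eighth power of the parameter itself. The quotient of the two functions is thus a continuous function to the eighth roots of
  unity, and it equals \<open>1\<close> at the origin.
\<close>

theorem eta_quotient_eq_hauptmodul:
  assumes q: "norm q < 1"
  shows "eta_quotient q = hauptmodul q"
proof -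
  have pow: "norm (z ^ k) < 1" if "norm z < 1" "k > 0" for k and z :: complex
    using norm_power_lt_1 that by blast
  define R where "R = (\<lambda>q. eta_quotient q / hauptmodul q)"
  have unity: "R z ^ 8 = 1" if z: "norm z < 1" for z
  proof -
    define e1 e2 e3 e4 e6 e12 where e: "e1 = euler z" "e2 = euler (z\<^sup>2)" "e3 = euler (z ^ 3)"
      "e4 = euler (z ^ 4)" "e6 = euler (z ^ 6)" "e12 = euler (z ^ 12)"
    have nz: "e1 \<noteq> 0" "e2 \<noteq> 0" "e3 \<noteq> 0" "e4 \<noteq> 0" "e6 \<noteq> 0" "e12 \<noteq> 0"
      using z by (auto simp: e intro!: euler_nonzero pow)
    define X where "X = hauptmodul z"
    note av = hauptmodul_avoids[OF z, folded X_def]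
    define a b where ab: "a = e1 ^ 4 * e4 ^ 2 / e2 ^ 6" "b = e3 ^ 4 * e12 ^ 2 / e6 ^ 6"
    have a: "a ^ 4 = X * (2 - X) ^ 3 / (2 * X - 1) ^ 3"
      using modular_lambda_hauptmodul(2)[OF z] one_minus_modular_lambda_eq_euler[OF z] by (simp add: X_def ab e)
    have b: "b ^ 4 = X ^ 3 * (2 - X) / (2 * X - 1)"
      using modular_lambda_hauptmodul(3)[OF z] one_minus_modular_lambda_eq_euler[OF pow[OF z, of 3]] by (simp add: X_def ab e power_mult[symmetric])
    have sq: "(eta_quotient z)\<^sup>2 = b ^ 3 / a"
      unfolding eta_quotient_def e[symmetric] ab using nz
      by (simp add: power_divide power_mult_distrib divide_simps flip: power_mult)
    have "eta_quotient z ^ 8 = (eta_quotient z ^ 2) ^ 4" by (simp flip: power_mult)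
    also have "\<dots> = (b ^ 4) ^ 3 / a ^ 4" unfolding sq by (simp add: power_divide flip: power_mult)
    also have "\<dots> = (X ^ 3 * Y / Z) ^ 3 / (X * Y ^ 3 / Z ^ 3)" if "Y = 2 - X" "Z = 2 * X - 1" for Y Z
      unfolding a b that ..
    also have "(X ^ 3 * Y / Z) ^ 3 / (X * Y ^ 3 / Z ^ 3) = X ^ 8" if "Y = 2 - X" "Z = 2 * X - 1" for Y Z
    proof -
      have "Y \<noteq> 0" "Z \<noteq> 0" using av that by auto
      then show ?thesis using av(1) by (simp add: power_divide power_mult_distrib divide_simps) (simp add: eval_nat_numeral)
    qed
    finally show ?thesis using av(1) by (simp add: R_def power_divide X_def[symmetric])
  qed
  have "continuous_on (ball 0 1) R"
    unfolding continuous_on_eq_continuous_at[OF open_ball]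
  proof
    fix z :: complex assume "z \<in> ball 0 1"
    then have z: "norm z < 1" by simp
    have E: "isCont (\<lambda>z. euler (z ^ k)) z" if "k > 0" for k
      by (rule isCont_o2[where g = euler]) (auto intro!: isCont_euler pow z that)
    have H: "isCont hauptmodul z"
      using holomorphic_on_imp_continuous_on[OF holomorphic_hauptmodul] z
      by (auto simp: continuous_on_eq_continuous_at)
    show "isCont R z"
      unfolding R_def eta_quotient_def
      by (intro isCont_divide isCont_mult isCont_power E H isCont_euler z)
         (use z hauptmodul_avoids(1)[OF z] in \<open>auto intro!: euler_nonzero pow simp: \<close>)
  qed
  moreover have "finite (R ` ball 0 1)"
    by (rule finite_subset[OF _ finite_roots_unity[of 8]]) (use unity in auto)
  ultimately have "R constant_on ball 0 1"
    by (intro continuous_finite_range_constant) auto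
  then have "R q = R 0" using q by (auto simp: constant_on_def)
  also have "R 0 = 1"
    by (simp add: R_def eta_quotient_def euler_0 hauptmodul_def cubic_f_def cubic_w_def phi_0 psi_0)
  finally show ?thesis using hauptmodul_avoids(1)[OF q] by (simp add: R_def)
qed

lemma modular_lambda_derivative:
  assumes q: "norm q < 1"
  obtains l where "(modular_lambda has_field_derivative l) (at q)" "q * l = modular_lambda q * (1 - modular_lambda q) * phi q ^ 4"
proof
  have nz: "phi q \<noteq> 0" "phi (- q) \<noteq> 0" using cubic_nonzero[OF q] by auto
  define t A B where "t = phi (- q) / phi q" "A = logderiv_phi q" "B = logderiv_phi (- q)"
  note defs = this
  have D: "deriv phi q = phi q * A" "deriv phi (- q) = phi (- q) * B"
    using nz by (simp_all add: defs logderiv_phi_def)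
  have "((\<lambda>q. phi (- q) / phi q) has_field_derivative
      (deriv phi (- q) * - 1 * phi q - phi (- q) * deriv phi q) / (phi q * phi q)) (at q)"
    using q nz by (auto intro!: derivative_eq_intros)
  also have "(deriv phi (- q) * - 1 * phi q - phi (- q) * deriv phi q) / (phi q * phi q) = - (t * (A + B))"
    unfolding D using nz by (simp add: defs(1) field_simps)
  finally have T: "((\<lambda>q. phi (- q) / phi q) has_field_derivative - (t * (A + B))) (at q)" .
  show "(modular_lambda has_field_derivative 4 * t ^ 4 * (A + B)) (at q)"
    unfolding modular_lambda_def[abs_def] using DERIV_diff[OF DERIV_const DERIV_power[OF T, of 4]]
    by (rule DERIV_cong) (simp add: defs(1)[symmetric] eval_nat_numeral algebra_simps)
  have t4: "t ^ 4 = 1 - modular_lambda q" by (simp add: modular_lambda_def defs)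
  have W: "psi (q\<^sup>2) ^ 4 = 4 * (A + B)"
    unfolding defs(2,3) logderiv_phi_ratio[OF q] by simp
  have "q * (4 * t ^ 4 * (A + B)) = t ^ 4 * (q * psi (q\<^sup>2) ^ 4)"
    unfolding W by (simp only: mult_ac)
  also have "\<dots> = modular_lambda q * (1 - modular_lambda q) * phi q ^ 4"
    unfolding t4 modular_lambda_alt[OF q] using nz by simp
  finally show "q * (4 * t ^ 4 * (A + B)) = modular_lambda q * (1 - modular_lambda q) * phi q ^ 4" .
qed

text \<open>
  The classical formula \<open>q \<lambda>' = \<lambda> (1 - \<lambda>) \<theta>\<^sub>3\<^sup>4\<close>, transported through the covering \<open>x \<mapsto> \<lambda>\<close>. The ramification
  cancels, which leaves simple zeros at the finite punctures other than \<open>1/2\<close>.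
\<close>

theorem hauptmodul_derivative:
  assumes q: "norm q < 1" "q \<noteq> 0"
  defines "X \<equiv> hauptmodul q"
  shows "q * deriv hauptmodul q = phi q ^ 4 * (X * (2 - X) * (X\<^sup>2 - 1)) / (2 * (2 * X - 1)\<^sup>2)"
proof -
  define D where "D = deriv hauptmodul q"
  have H: "(hauptmodul has_field_derivative D) (at q)"
    unfolding D_def by (rule holomorphic_derivI[OF holomorphic_hauptmodul open_ball]) (use q in simp)
  obtain l where l: "(modular_lambda has_field_derivative l) (at q)" "q * l = modular_lambda q * (1 - modular_lambda q) * phi q ^ 4"
    using modular_lambda_derivative[OF q(1)] .
  note av = hauptmodul_avoids[OF q(1), folded X_def] 
  define Z where "Z = 2 * X - 1"
  have Z: "Z \<noteq> 0" using av by (simp add: Z_def)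
  have eq: "modular_lambda z * (2 * hauptmodul z - 1) ^ 3 = (hauptmodul z - 1) * (hauptmodul z + 1) ^ 3" if "norm z < 1" for z
    using modular_lambda_hauptmodul(1)[OF that] hauptmodul_param(1)[OF that] by simp
  have "l * Z ^ 3 + modular_lambda q * (3 * Z ^ 2 * (2 * D)) = D * (X + 1) ^ 3 + (X - 1) * (3 * (X + 1) ^ 2 * D)"
  proof (rule DERIV_eq_on_ball[OF _ _ eq q(1)])
    show "((\<lambda>z. modular_lambda z * (2 * hauptmodul z - 1) ^ 3) has_field_derivative l * Z ^ 3 + modular_lambda q * (3 * Z ^ 2 * (2 * D))) (at q)"
      by (auto intro!: derivative_eq_intros l(1) H simp: Z_def X_def)
    show "((\<lambda>z. (hauptmodul z - 1) * (hauptmodul z + 1) ^ 3) has_field_derivative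
       D * (X + 1) ^ 3 + (X - 1) * (3 * (X + 1) ^ 2 * D)) (at q)"
      by (auto intro!: derivative_eq_intros H simp: X_def)
  qed
  moreover have L: "modular_lambda q * Z ^ 3 = (X - 1) * (X + 1) ^ 3" "(1 - modular_lambda q) * Z ^ 3 = X * (2 - X) ^ 3"
    using modular_lambda_hauptmodul[OF q(1)] Z by (simp_all add: X_def Z_def)
  ultimately have "l * Z ^ 4 = 2 * (X + 1)\<^sup>2 * (2 - X)\<^sup>2 * D"
    unfolding Z_def by algebra
  then have "2 * (X + 1)\<^sup>2 * (2 - X)\<^sup>2 * (q * D) * Z\<^sup>2 = (q * l) * Z ^ 6"
    by (simp add: eval_nat_numeral mult_ac)
  also have "\<dots> = phi q ^ 4 * (modular_lambda q * Z ^ 3) * ((1 - modular_lambda q) * Z ^ 3)"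
    unfolding l(2) by (simp add: eval_nat_numeral mult_ac)
  also have "\<dots> = (X + 1)\<^sup>2 * (2 - X)\<^sup>2 * (phi q ^ 4 * (X * (2 - X) * (X\<^sup>2 - 1)))"
    unfolding L by (simp add: power2_eq_square power3_eq_cube algebra_simps)
  finally have "((X + 1)\<^sup>2 * (2 - X)\<^sup>2) * (2 * Z\<^sup>2 * (q * D)) =
      ((X + 1)\<^sup>2 * (2 - X)\<^sup>2) * (phi q ^ 4 * (X * (2 - X) * (X\<^sup>2 - 1)))"
    by (simp only: mult_ac)
  moreover have "(X + 1)\<^sup>2 * (2 - X)\<^sup>2 \<noteq> 0"
    using av q by (auto simp: eq_neg_iff_add_eq_0)
  ultimately have "2 * Z\<^sup>2 * (q * D) = phi q ^ 4 * (X * (2 - X) * (X\<^sup>2 - 1))"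
    by (metis mult_left_cancel)
  then show ?thesis using Z unfolding D_def[symmetric] Z_def[symmetric] by (simp add: field_simps)
qed

section \<open>The Schwarzian differential equation\<close>

text \<open>
  With \<open>y'' = y' T\<close> the Schwarzian derivative is \<open>T' - T\<^sup>2 / 2\<close>.
\<close>

lemma schwarzian_via_factors:
  assumes "open A" "s \<in> A"
    and 1: "\<And>z. z \<in> A \<Longrightarrow> (y has_field_derivative y1 z) (at z)"
    and 2: "\<And>z. z \<in> A \<Longrightarrow> (y1 has_field_derivative y1 z * T z) (at z)"
    and 3: "\<And>z. z \<in> A \<Longrightarrow> (T has_field_derivative T' z) (at z)"
    and nz: "y1 s \<noteq> 0"
  shows "deriv y s = y1 s" "schwarzian y s = T' s - (T s)\<^sup>2 / 2"
proof -
  have ev: "eventually (\<lambda>z. z \<in> A) (nhds z)" if "z \<in> A" for z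
    by (rule eventually_nhds_in_open[OF assms(1) that])
  have d1: "deriv y z = y1 z" if "z \<in> A" for z
    by (rule DERIV_imp_deriv[OF 1[OF that]])
  have d2: "deriv (deriv y) z = y1 z * T z" if "z \<in> A" for z
  proof -
    have "deriv (deriv y) z = deriv y1 z"
      by (rule deriv_cong_ev[OF eventually_mono[OF ev[OF that] d1] refl])
    then show ?thesis using DERIV_imp_deriv[OF 2[OF that]] by simp
  qed
  have "deriv (deriv (deriv y)) s = deriv (\<lambda>z. y1 z * T z) s"
    by (rule deriv_cong_ev[OF eventually_mono[OF ev[OF assms(2)] d2] refl])
  also have "\<dots> = y1 s * T s * T s + y1 s * T' s"
    by (rule DERIV_imp_deriv, rule DERIV_cong[OF DERIV_mult'[OF 2[OF assms(2)] 3[OF assms(2)]]]) (simp add: add.commute)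
  finally have d3: "deriv (deriv (deriv y)) s = y1 s * T s * T s + y1 s * T' s" .
  show "deriv y s = y1 s" by (rule d1[OF assms(2)])
  have "(deriv ^^ 3) y = deriv (deriv (deriv y))" "(deriv ^^ 2) y = deriv (deriv y)"
    by (simp_all add: numeral_3_eq_3 numeral_2_eq_2)
  then show "schwarzian y s = T' s - (T s)\<^sup>2 / 2"
    unfolding schwarzian_def using nz
    by (simp add: d1[OF assms(2)] d2[OF assms(2)] d3 field_simps power2_eq_square)
qed

lemma DERIV_divide_denominator_power:
  fixes N :: "complex \<Rightarrow> complex"
  assumes N: "(N has_field_derivative N') (at a)" and a: "2 * a - 1 \<noteq> 0" and "k > 0"
  shows "((\<lambda>x. N x / (2 * (2 * x - 1) ^ k)) has_field_derivative
     (N' * (2 * a - 1) - 2 * of_nat k * N a) / (2 * (2 * a - 1) ^ Suc k)) (at a)"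
proof -
  obtain m where k: "k = Suc m" using \<open>k > 0\<close> gr0_conv_Suc by blast
  define Z where "Z = 2 * a - 1"
  have Z: "Z \<noteq> 0" using a by (simp add: Z_def)
  have lin: "((\<lambda>x. 2 * x - 1) has_field_derivative 2) (at a)"
    by (auto intro!: derivative_eq_intros)
  have D: "((\<lambda>x. 2 * (2 * x - 1) ^ k) has_field_derivative 4 * of_nat k * Z ^ m) (at a)"
    by (rule DERIV_cong[OF DERIV_cmult[OF DERIV_power[OF lin]]]) (simp add: k Z_def)
  have "((\<lambda>x. N x / (2 * (2 * x - 1) ^ k)) has_field_derivative
     (N' * (2 * Z ^ k) - N a * (4 * of_nat k * Z ^ m)) / ((2 * Z ^ k) * (2 * Z ^ k))) (at a)"
    using DERIV_divide[OF N D] Z by (simp add: Z_def)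
  also have "(N' * (2 * Z ^ k) - N a * (4 * of_nat k * Z ^ m)) / ((2 * Z ^ k) * (2 * Z ^ k)) =
      (2 * Z ^ m * (N' * Z - 2 * of_nat k * N a)) / (2 * Z ^ m * (2 * Z ^ Suc k))"
    by (simp add: k algebra_simps)
  also have "\<dots> = (N' * Z - 2 * of_nat k * N a) / (2 * Z ^ Suc k)"
    by (rule mult_divide_mult_cancel_left) (use Z in simp)
  finally show ?thesis by (simp add: Z_def)
qed

text \<open>
  The functions \<open>x\<close>, \<open>U = \<theta>\<^sub>3\<^sup>2\<close> and the logarithmic derivative \<open>l\<close> of \<open>U\<close> satisfy a closed system of
  first-order equations. In \<open>T' - T\<^sup>2 / 2\<close> the terms with \<open>l\<close> cancel, and what is left is \<open>U\<^sup>4\<close> times a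
  rational function of \<open>x\<close>; the comparison with \<open>(x')\<^sup>2\<close> is an identity of polynomials.
\<close>

lemma schwarzian_of_theta_system:
  fixes x U l :: "complex \<Rightarrow> complex" and c :: complex
  assumes A: "open A" "s \<in> A"
    and dx: "\<And>z. z \<in> A \<Longrightarrow> (x has_field_derivative
          c * (U z)\<^sup>2 * (x z * (2 - x z) * ((x z)\<^sup>2 - 1)) / (2 * (2 * x z - 1)\<^sup>2)) (at z)"
    and dU: "\<And>z. z \<in> A \<Longrightarrow> (U has_field_derivative c * (U z * l z)) (at z)"
    and dl: "\<And>z. z \<in> A \<Longrightarrow> (l has_field_derivative
          c * ((l z)\<^sup>2 + U z ^ 4 * ((x z - 1) * (x z + 1) ^ 3 * (x z * (2 - x z) ^ 3)) / (4 * (2 * x z - 1) ^ 6))) (at z)"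
    and avoid: "\<And>z. z \<in> A \<Longrightarrow> 2 * x z - 1 \<noteq> 0"
    and nz: "c \<noteq> 0" "U s \<noteq> 0" "x s \<noteq> 0" "x s \<noteq> 1" "x s \<noteq> -1" "x s \<noteq> 2"
  defines "X \<equiv> x s"
  shows "deriv x s \<noteq> 0"
    and "X\<^sup>2 * (X - 1)\<^sup>2 * (X + 1)\<^sup>2 * (X - 2)\<^sup>2 * (2 * X - 1)\<^sup>2 \<noteq> 0"
    and "schwarzian x s + 2 * (X\<^sup>2 - X + 1) ^ 4 /
           (X\<^sup>2 * (X - 1)\<^sup>2 * (X + 1)\<^sup>2 * (X - 2)\<^sup>2 * (2 * X - 1)\<^sup>2) * (deriv x s)\<^sup>2 = 0"
proof -
  \<comment> \<open>The rational function with \<open>x' = c U\<^sup>2 S(x)\<close>, and its first two derivatives.\<close>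
  define S S1 S2 :: "complex \<Rightarrow> complex" where
    S: "S = (\<lambda>x. x * (2 - x) * (x\<^sup>2 - 1) / (2 * (2 * x - 1)\<^sup>2))"
    "S1 = (\<lambda>x. (- 4 * x ^ 4 + 8 * x ^ 3 - 6 * x\<^sup>2 + 2 * x + 2) / (2 * (2 * x - 1) ^ 3))"
    "S2 = (\<lambda>x. (- 8 * x ^ 4 + 16 * x ^ 3 - 12 * x\<^sup>2 + 4 * x - 14) / (2 * (2 * x - 1) ^ 4))"
  have DS: "(S has_field_derivative S1 a) (at a)" if "2 * a - 1 \<noteq> 0" for a
  proof -
    have "((\<lambda>x. x * (2 - x) * (x\<^sup>2 - 1)) has_field_derivative - 4 * a ^ 3 + 6 * a\<^sup>2 + 2 * a - 2) (at a)"
      by (auto intro!: derivative_eq_intros simp: algebra_simps power2_eq_square power3_eq_cube)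
    from DERIV_divide_denominator_power[where k = 2, OF this that zero_less_numeral] show ?thesis
      unfolding S by (rule DERIV_cong) (simp add: algebra_simps eval_nat_numeral)
  qed
  have DS1: "(S1 has_field_derivative S2 a) (at a)" if "2 * a - 1 \<noteq> 0" for a
  proof -
    have "((\<lambda>x. - 4 * x ^ 4 + 8 * x ^ 3 - 6 * x\<^sup>2 + 2 * x + 2) has_field_derivative
        - 16 * a ^ 3 + 24 * a\<^sup>2 - 12 * a + 2) (at a)"
      by (auto intro!: derivative_eq_intros simp: algebra_simps power2_eq_square power3_eq_cube)
    from DERIV_divide_denominator_power[where k = 3, OF this that zero_less_numeral] show ?thesis
      unfolding S by (rule DERIV_cong) (simp add: algebra_simps eval_nat_numeral)
  qed
  define y1 T T' where y1: "y1 = (\<lambda>z. c * ((U z)\<^sup>2 * S (x z)))"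
    and T: "T = (\<lambda>z. c * (2 * l z + (U z)\<^sup>2 * S1 (x z)))"
    and T': "T' = (\<lambda>z. c * (2 * (c * ((l z)\<^sup>2 + U z ^ 4 * ((x z - 1) * (x z + 1) ^ 3 * (x z * (2 - x z) ^ 3)) / (4 * (2 * x z - 1) ^ 6)))
        + (2 * U z * (c * (U z * l z)) * S1 (x z) + (U z)\<^sup>2 * (S2 (x z) * y1 z))))"
  have x1: "(x has_field_derivative y1 z) (at z)" if "z \<in> A" for z
    using dx[OF that] by (simp add: y1 S mult.assoc)
  have U2: "((\<lambda>z. (U z)\<^sup>2) has_field_derivative 2 * U z * (c * (U z * l z))) (at z)" if "z \<in> A" for z
    using DERIV_power[OF dU[OF that], of 2] by (simp add: mult_ac)
  have x2: "(y1 has_field_derivative y1 z * T z) (at z)" if "z \<in> A" for z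
  proof -
    have "(y1 has_field_derivative c * ((U z)\<^sup>2 * (S1 (x z) * y1 z) + 2 * U z * (c * (U z * l z)) * S (x z))) (at z)"
      by (subst y1, rule DERIV_cmult, rule DERIV_mult'[OF U2[OF that] DERIV_chain2[OF DS[OF avoid[OF that]] x1[OF that]]])
    then show ?thesis by (rule DERIV_cong) (simp add: y1 T power2_eq_square algebra_simps)
  qed
  have x3: "(T has_field_derivative T' z) (at z)" if "z \<in> A" for z
  proof -
    have "(T has_field_derivative c * (2 * (c * ((l z)\<^sup>2 + U z ^ 4 * ((x z - 1) * (x z + 1) ^ 3 * (x z * (2 - x z) ^ 3)) / (4 * (2 * x z - 1) ^ 6)))
        + ((U z)\<^sup>2 * (S2 (x z) * y1 z) + 2 * U z * (c * (U z * l z)) * S1 (x z)))) (at z)"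
      by (subst T, rule DERIV_cmult, rule DERIV_add, rule DERIV_cmult, rule dl[OF that],
          rule DERIV_mult'[OF U2[OF that] DERIV_chain2[OF DS1[OF avoid[OF that]] x1[OF that]]])
    then show ?thesis by (rule DERIV_cong) (simp only: T' add.commute)
  qed
  define Z where "Z = 2 * X - 1"
  have Z: "Z \<noteq> 0" using avoid[OF A(2)] by (simp add: Z_def X_def)
  have X: "X \<noteq> 0" "X - 1 \<noteq> 0" "X + 1 \<noteq> 0" "X - 2 \<noteq> 0" "2 - X \<noteq> 0"
    using nz by (auto simp: X_def eq_neg_iff_add_eq_0)
  have X1: "X\<^sup>2 - 1 \<noteq> 0" using X(2,3) by (metis mult_eq_0_iff power2_eq_square square_diff_one_factored)
  have y1s: "y1 s = c * (U s)\<^sup>2 * (X * (2 - X) * (X\<^sup>2 - 1)) / (2 * Z\<^sup>2)"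
    by (simp add: y1 S Z_def X_def)
  have y1nz: "y1 s \<noteq> 0"
    unfolding y1s using nz X X1 Z by simp
  note sch = schwarzian_via_factors[OF A x1 x2 x3 y1nz]
  show "deriv x s \<noteq> 0" using sch(1) y1nz by simp
  show P: "X\<^sup>2 * (X - 1)\<^sup>2 * (X + 1)\<^sup>2 * (X - 2)\<^sup>2 * (2 * X - 1)\<^sup>2 \<noteq> 0"
    using X Z by (simp add: Z_def)
  define n1 n2 where n: "n1 = - 4 * X ^ 4 + 8 * X ^ 3 - 6 * X\<^sup>2 + 2 * X + 2" "n2 = - 8 * X ^ 4 + 16 * X ^ 3 - 12 * X\<^sup>2 + 4 * X - 14"
  define N where "N = X * (2 - X) * (X\<^sup>2 - 1)"
  have S1s: "S1 X = n1 / (2 * Z ^ 3)" and S2s: "S2 X = n2 / (2 * Z ^ 4)" by (simp_all add: S n Z_def)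
  have y1N: "y1 s = c * (U s)\<^sup>2 * N / (2 * Z\<^sup>2)" unfolding y1s N_def ..
  define W where "W = (X - 1) * (X + 1) ^ 3 * (X * (2 - X) ^ 3)"
  \<comment> \<open>This identity produces the numerator \<open>(x\<^sup>2 - x + 1) ^ 4\<close> of the equation.\<close>
  have key: "4 * W + 2 * N * n2 - n1\<^sup>2 = - 4 * (X\<^sup>2 - X + 1) ^ 4"
    unfolding W_def N_def n by algebra
  have "T' s - (T s)\<^sup>2 / 2 = c\<^sup>2 * U s ^ 4 * (4 * W + 2 * N * n2 - n1\<^sup>2) / (8 * Z ^ 6)"
    unfolding T' T X_def[symmetric] y1N S1s S2s W_def[symmetric] Z_def[symmetric]
    using Z by (simp add: divide_simps) (simp add: eval_nat_numeral algebra_simps)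
  also have "\<dots> = - (c\<^sup>2 * U s ^ 4 * (X\<^sup>2 - X + 1) ^ 4 / (2 * Z ^ 6))"
    unfolding key using Z by (simp add: field_simps)
  finally have sc: "schwarzian x s = - (c\<^sup>2 * U s ^ 4 * (X\<^sup>2 - X + 1) ^ 4 / (2 * Z ^ 6))"
    using sch(2) by simp
  have P': "X\<^sup>2 * (X - 1)\<^sup>2 * (X + 1)\<^sup>2 * (X - 2)\<^sup>2 * (2 * X - 1)\<^sup>2 = N\<^sup>2 * Z\<^sup>2"
    unfolding N_def Z_def by algebra
  have N0: "N \<noteq> 0" using X X1 by (simp add: N_def)
  have "2 * (X\<^sup>2 - X + 1) ^ 4 / (N\<^sup>2 * Z\<^sup>2) * (y1 s)\<^sup>2 = c\<^sup>2 * U s ^ 4 * (X\<^sup>2 - X + 1) ^ 4 / (2 * Z ^ 6)"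
    unfolding y1N using N0 Z by (simp add: divide_simps power_mult_distrib)
  then show "schwarzian x s + 2 * (X\<^sup>2 - X + 1) ^ 4 /
           (X\<^sup>2 * (X - 1)\<^sup>2 * (X + 1)\<^sup>2 * (X - 2)\<^sup>2 * (2 * X - 1)\<^sup>2) * (deriv x s)\<^sup>2 = 0"
    unfolding P' sc by (simp add: sch(1))
qed

text \<open>
  Half arguments of \<open>\<eta>\<close> require the nome \<open>exp (\<pi> \<i> \<tau>)\<close> instead of \<open>exp (2 \<pi> \<i> \<tau>)\<close>.
\<close>

definition nome :: "complex \<Rightarrow> complex" where
  "nome \<tau> = exp (\<i> * pi * \<tau>)"

lemma norm_nome: "norm (nome \<tau>) < 1" if "\<tau> \<in> upper_half_plane"
  using that by (simp add: nome_def upper_half_plane_def)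

lemma nome_nonzero: "nome \<tau> \<noteq> 0"
  by (simp add: nome_def)

lemma dedekind_eta_nome:
  "dedekind_eta (of_nat k * \<tau> / 2) = exp (\<i> * pi * \<tau> / 24) ^ k * euler (nome \<tau> ^ k)"
proof -
  have "exp (2 * pi * \<i> * of_nat (Suc n) * (of_nat k * \<tau> / 2)) = (nome \<tau> ^ k) ^ Suc n" for n
  proof -
    have "2 * pi * \<i> * of_nat (Suc n) * (of_nat k * \<tau> / 2) = of_nat (Suc n) * (of_nat k * (\<i> * pi * \<tau>))"
      by simp
    then show ?thesis unfolding nome_def by (simp only: exp_of_nat_mult)
  qed
  moreover have "exp (2 * pi * \<i> * (of_nat k * \<tau> / 2) / 24) = exp (\<i> * pi * \<tau> / 24) ^ k"
    by (simp only: exp_of_nat_mult[symmetric]) (simp add: field_simps)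
  ultimately show ?thesis unfolding dedekind_eta_def euler_def by simp
qed

text \<open>
  The fractional powers of the nome in the eta functions cancel: numerator and denominator both have
  total weight \<open>60\<close> in units of \<open>exp (\<pi> \<i> \<tau> / 24)\<close>.
\<close>

lemma x_fun_eq_hauptmodul:
  assumes "\<tau> \<in> upper_half_plane"
  shows "x_fun \<tau> = hauptmodul (nome \<tau>)"
proof -
  define e where "e = exp (\<i> * pi * \<tau> / 24)"
  have e: "e \<noteq> 0" by (simp add: e_def)
  note E = dedekind_eta_nome[of _ \<tau>, folded e_def]
  define E1 E2 E3 E4 E6 E12 where Es: "E1 = euler (nome \<tau>)" "E2 = euler (nome \<tau> ^ 2)" "E3 = euler (nome \<tau> ^ 3)"
    "E4 = euler (nome \<tau> ^ 4)" "E6 = euler (nome \<tau> ^ 6)" "E12 = euler (nome \<tau> ^ 12)"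
  have "x_fun \<tau> = ((e ^ 2 * E2) ^ 3 * (e ^ 3 * E3) ^ 6 * (e ^ 12 * E12) ^ 3) / ((e * E1) ^ 2 * (e ^ 4 * E4) * (e ^ 6 * E6) ^ 9)"
    using E[of 1] E[of 2] E[of 3] E[of 4] E[of 6] E[of 12]
    by (simp add: x_fun_def Es mult.commute)
  also have "(e ^ 2 * E2) ^ 3 * (e ^ 3 * E3) ^ 6 * (e ^ 12 * E12) ^ 3 = (e ^ 6 * e ^ 18 * e ^ 36) * (E2 ^ 3 * E3 ^ 6 * E12 ^ 3)"
    by (simp add: power_mult_distrib mult_ac flip: power_mult)
  also have "(e * E1) ^ 2 * (e ^ 4 * E4) * (e ^ 6 * E6) ^ 9 = (e ^ 2 * e ^ 4 * e ^ 54) * (E1 ^ 2 * E4 * E6 ^ 9)"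
    by (simp add: power_mult_distrib mult_ac flip: power_mult)
  also have "e ^ 6 * e ^ 18 * e ^ 36 = e ^ 60" by (simp flip: power_add)
  also have "e ^ 2 * e ^ 4 * e ^ 54 = e ^ 60" by (simp flip: power_add)
  finally have "x_fun \<tau> = eta_quotient (nome \<tau>)"
    using e by (simp add: eta_quotient_def Es)
  then show ?thesis
    using eta_quotient_eq_hauptmodul[OF norm_nome[OF assms]] by simp
qed

lemma DERIV_nome: "(nome has_field_derivative \<i> * pi * nome \<tau>) (at \<tau>)"
  unfolding nome_def[abs_def] by (auto intro!: derivative_eq_intros)

lemma open_upper_half_plane: "open upper_half_plane"
  unfolding upper_half_plane_def by (simp add: open_halfspace_Im_gt)

lemma x_fun_derivative:
  assumes z: "z \<in> upper_half_plane"
  shows "(x_fun has_field_derivative \<i> * pi * ((phi (nome z))\<^sup>2)\<^sup>2 *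
     (x_fun z * (2 - x_fun z) * ((x_fun z)\<^sup>2 - 1)) / (2 * (2 * x_fun z - 1)\<^sup>2)) (at z)"
proof -
  have n: "norm (nome z) < 1" by (rule norm_nome[OF z])
  have "((\<lambda>z. hauptmodul (nome z)) has_field_derivative deriv hauptmodul (nome z) * (\<i> * pi * nome z)) (at z)"
    by (rule DERIV_chain2[OF holomorphic_derivI[OF holomorphic_hauptmodul open_ball] DERIV_nome]) (use n in simp)
  moreover have ev: "eventually (\<lambda>w. hauptmodul (nome w) = x_fun w) (nhds z)"
    using eventually_nhds_in_open[OF open_upper_half_plane z]
    by eventually_elim (simp add: x_fun_eq_hauptmodul)
  ultimately have "(x_fun has_field_derivative deriv hauptmodul (nome z) * (\<i> * pi * nome z)) (at z)"
    using DERIV_cong_ev[OF refl ev refl] by blast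
  moreover have "deriv hauptmodul (nome z) * (\<i> * pi * nome z) = \<i> * pi * (nome z * deriv hauptmodul (nome z))"
    by simp
  ultimately show ?thesis
    unfolding hauptmodul_derivative[OF n nome_nonzero] x_fun_eq_hauptmodul[OF z, symmetric]
    by (simp add: mult.assoc flip: power_mult)
qed

theorem theorem12p1:
  fixes \<tau> :: complex
  assumes "\<tau> \<in> upper_half_plane"
  shows "let x = x_fun \<tau>; x' = deriv x_fun \<tau> in
           x' \<noteq> 0 \<and>
           x\<^sup>2 * (x - 1)\<^sup>2 * (x + 1)\<^sup>2 * (x - 2)\<^sup>2 * (2 * x - 1)\<^sup>2 \<noteq> 0 \<and>
           schwarzian x_fun \<tau> +
             2 * (x\<^sup>2 - x + 1) ^ 4 /
             (x\<^sup>2 * (x - 1)\<^sup>2 * (x + 1)\<^sup>2 * (x - 2)\<^sup>2 * (2 * x - 1)\<^sup>2) * x'\<^sup>2 = 0"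
proof -
  define U l where "U = (\<lambda>z. (phi (nome z))\<^sup>2)" and "l = (\<lambda>z. log_deriv_phi_square (nome z))"
  have avoids: "x_fun z \<noteq> 0" "x_fun z \<noteq> 2" "2 * x_fun z \<noteq> 1" "x_fun z \<noteq> 1" "x_fun z \<noteq> -1"
    if "z \<in> upper_half_plane" for z
    using hauptmodul_avoids[OF norm_nome[OF that]] nome_nonzero[of z]
    by (simp_all add: x_fun_eq_hauptmodul[OF that])
  have dU: "(U has_field_derivative \<i> * pi * (U z * l z)) (at z)" if "z \<in> upper_half_plane" for z
  proof -
    have "(U has_field_derivative 2 * phi (nome z) * (deriv phi (nome z) * (\<i> * pi * nome z))) (at z)"
      unfolding U_def using norm_nome[OF that] by (auto intro!: derivative_eq_intros DERIV_nome)
    moreover have "deriv phi (nome z) = phi (nome z) * logderiv_phi (nome z)"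
      using phi_nonzero[OF norm_nome[OF that]] by (simp add: logderiv_phi_def)
    ultimately show ?thesis
      by (simp add: U_def l_def log_deriv_phi_square_def power2_eq_square mult_ac)
  qed
  have dl: "(l has_field_derivative \<i> * pi * ((l z)\<^sup>2 + U z ^ 4 * ((x_fun z - 1) * (x_fun z + 1) ^ 3 *
       (x_fun z * (2 - x_fun z) ^ 3)) / (4 * (2 * x_fun z - 1) ^ 6))) (at z)"
    if z: "z \<in> upper_half_plane" for z
  proof -
    define q x where "q = nome z" and "x = x_fun z"
    have n: "norm q < 1" using norm_nome[OF that] by (simp add: q_def)
    note L = modular_lambda_hauptmodul(1,2)[OF n, unfolded q_def, folded x_fun_eq_hauptmodul[OF z], folded q_def x_def]
    have "phi (- q) ^ 4 * (phi q ^ 4 - phi (- q) ^ 4) = phi q ^ 8 * (modular_lambda q * (1 - modular_lambda q))"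
      using phi_nonzero[OF n] by (simp add: modular_lambda_def power_divide field_simps flip: power_add)
    also have "\<dots> = U z ^ 4 * ((x - 1) * (x + 1) ^ 3 * (x * (2 - x) ^ 3)) / (2 * x - 1) ^ 6"
      unfolding L(2) unfolding L(1) by (simp add: U_def q_def flip: power_mult power_add)
    finally have r: "q * deriv log_deriv_phi_square q = (l z)\<^sup>2 +
        U z ^ 4 * ((x - 1) * (x + 1) ^ 3 * (x * (2 - x) ^ 3)) / (4 * (2 * x - 1) ^ 6)"
      unfolding theta_riccati[OF n] by (simp add: l_def q_def)
    have "(l has_field_derivative deriv log_deriv_phi_square q * (\<i> * pi * q)) (at z)"
      unfolding l_def q_def using norm_nome[OF that] by (auto intro!: derivative_eq_intros DERIV_nome)
    moreover have "deriv log_deriv_phi_square q * (\<i> * pi * q) = \<i> * pi * (q * deriv log_deriv_phi_square q)" by simp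
    ultimately show ?thesis unfolding r x_def by (simp only:)
  qed
  have U0: "U \<tau> \<noteq> 0" using phi_nonzero[OF norm_nome[OF assms]] by (simp add: U_def)
  have dx: "(x_fun has_field_derivative \<i> * pi * (U z)\<^sup>2 *
     (x_fun z * (2 - x_fun z) * ((x_fun z)\<^sup>2 - 1)) / (2 * (2 * x_fun z - 1)\<^sup>2)) (at z)"
    if "z \<in> upper_half_plane" for z
    using x_fun_derivative[OF that] by (simp add: U_def)
  have av: "2 * x_fun z - 1 \<noteq> 0" if "z \<in> upper_half_plane" for z
    using avoids(3)[OF that] by simp
  have "\<i> * complex_of_real pi \<noteq> 0" by simp
  note final = schwarzian_of_theta_system[OF open_upper_half_plane assms dx dU dl av this U0 avoids(1,4,5,2)[OF assms]]
  show ?thesis unfolding Let_def using final by blast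
qed

end
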